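(* Let $D$ be a $C$-central division algebra of degree $n$ over a field $C$, let $\sigma\in{\rm Aut}(D)$ be such that $\sigma|_C$ has finite order $m$, and put $F={\rm Fix}(\sigma)\cap C$. Let $d\in C\setminus F$. Then $C/F$ is a cyclic Galois field extension of degree $m$ with Galois group $G=\langle\sigma|_C\rangle$. Let $H=\{\tau\in G\mid\tau(d)=d\}$. Then $H=\langle(\sigma|_C)^s\rangle$ for some integer $s$ such that $m=sr$, and $${\rm Nuc}_r((D,\sigma,d))=D[t;\sigma^s]/(t^r-d).$$ In particular, if $m$ is prime then ${\rm Nuc}_r((D,\sigma,d))=D$.
   Context: Algebras are unital and not necessarily associative. For an algebra $A$, ${\rm Nuc}_r(A)=\{x\in A\mid (ab)x=a(bx)\text{ for all }a,b\in A\}$ is the right nucleus. For an automorphism $\rho$ of $D$, $D[t;\rho]$ is the skew polynomial ring with $ta=\rho(a)t$. For $d\in D^\times$, the nonassociative generalized cyclic algebra $(D,\sigma,d)$ over $F$ is $D[t;\sigma]/D[t;\sigma]f$ with $f=t^m-d$: its underlying additive group is $\{g\in D[t;\sigma]\mid\deg g<m\}$, and the product of $g,h$ is the remainder of $gh$ after right division by $f$ (the unique $q'$, $\deg q'<m$, with $gh=qf+q'$ for some $q$). On the right-hand side of the displayed equality, $D[t;\sigma^s]/(t^r-d)$ is the associative quotient algebra of $D[t;\sigma^s]$ by the ideal generated by $t^r-d$; its variable is identified with the element $t^s$ of $(D,\sigma,d)$, so that it is the subspace $D\oplus Dt^s\oplus\dots\oplus Dt^{(r-1)s}$ of $(D,\sigma,d)$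 with the inherited multiplication.
   Formalization: The equality Nuc_r((D,σ,d)) = D[t;σ^s]/(t^r−d) and the claim for prime m are stated under the added assumption σ^m = id on all of D; without it D is not contained in Nuc_r and the quotient by (t^r−d) is zero, so both claims fail. *)

theory Defs
  imports "HOL-Algebra.Algebra" "HOL-Algebra.UnivPoly"
begin

section \<open>Central division algebras and Galois extensions\<close>

definition ring_center :: "('a, 'b) ring_scheme \<Rightarrow> 'a set" where
  "ring_center R = {x \<in> carrier R. \<forall>y \<in> carrier R. x \<otimes>\<^bsub>R\<^esub> y = y \<otimes>\<^bsub>R\<^esub> x}"

text \<open>The ground field is identified with its image, the center; degree \<open>n\<close> means dimension \<open>n\<^sup>2\<close>.\<close>

locale central_division_algebra = ring D for D (structure) +
  fixes C :: "'a set" and n :: nat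
  assumes Units_D: "Units D = carrier D - {\<zero>}"
    and center: "C = ring_center D"
    and subfield_C: "subfield C D"
    and degree: "dimension (n\<^sup>2) C (carrier D)"

definition ring_auto_group :: "('a, 'b) ring_scheme \<Rightarrow> ('a \<Rightarrow> 'a) monoid" where
  "ring_auto_group R = BijGroup (carrier R) \<lparr>carrier := ring_iso R R \<inter> extensional (carrier R)\<rparr>"

text \<open>Here \<open>F \<subseteq> E\<close> are subfields of an ambient ring \<open>R\<close>.\<close>

definition galois_group :: "('a, 'b) ring_scheme \<Rightarrow> 'a set \<Rightarrow> 'a set \<Rightarrow> ('a \<Rightarrow> 'a) monoid" where
  "galois_group R E F = (ring_auto_group (R\<lparr>carrier := E\<rparr>))
     \<lparr>carrier := {\<tau> \<in> carrier (ring_auto_group (R\<lparr>carrier := E\<rparr>)). \<forall>x \<in> F. \<tau> x = x}\<rparr>"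

definition galois_extension :: "('a, 'b) ring_scheme \<Rightarrow> 'a set \<Rightarrow> 'a set \<Rightarrow> bool" where
  "galois_extension R F E \<longleftrightarrow>
     subfield F R \<and> subfield E R \<and> F \<subseteq> E \<and> ring.finite_dimension R F E \<and>
     {x \<in> E. \<forall>\<tau> \<in> carrier (galois_group R E F). \<tau> x = x} = F"


section \<open>Skew polynomials and nonassociative generalized cyclic algebras\<close>

text \<open>
  The additive structure, the left scalar multiplication and the monomials are those of \<open>UP R\<close>;
  the multiplication is determined by \<open>t a = \<rho>(a) t\<close>, that is
  \<open>(a t\<^sup>i) (b t\<^sup>j) = a \<rho>\<^sup>i(b) t\<^sup>i\<^sup>+\<^sup>j\<close>.
\<close>

definition skew_poly :: "('a, 'b) ring_scheme \<Rightarrow> ('a \<Rightarrow> 'a) \<Rightarrow> ('a, nat \<Rightarrow> 'a) up_ring" where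
  "skew_poly R \<rho> = (UP R)
     \<lparr>mult := \<lambda>p \<in> up R. \<lambda>q \<in> up R. \<lambda>k. \<Oplus>\<^bsub>R\<^esub>i \<in> {..k}. p i \<otimes>\<^bsub>R\<^esub> (\<rho> ^^ i) (q (k - i))\<rparr>"

text \<open>The polynomial \<open>t\<^sup>k - d\<close>.\<close>

definition skew_binomial :: "('a, 'b) ring_scheme \<Rightarrow> ('a \<Rightarrow> 'a) \<Rightarrow> nat \<Rightarrow> 'a \<Rightarrow> nat \<Rightarrow> 'a" where
  "skew_binomial R \<rho> k d =
     monom (skew_poly R \<rho>) \<one>\<^bsub>R\<^esub> k \<ominus>\<^bsub>skew_poly R \<rho>\<^esub> monom (skew_poly R \<rho>) d 0"

text \<open>The remainder of \<open>g\<close> after right division by \<open>f\<close>.\<close>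

definition skew_rem ::
    "('a, 'b) ring_scheme \<Rightarrow> ('a \<Rightarrow> 'a) \<Rightarrow> (nat \<Rightarrow> 'a) \<Rightarrow> (nat \<Rightarrow> 'a) \<Rightarrow> nat \<Rightarrow> 'a" where
  "skew_rem R \<rho> g f = (THE q'. q' \<in> carrier (skew_poly R \<rho>) \<and> deg R q' < deg R f \<and>
     (\<exists>q \<in> carrier (skew_poly R \<rho>).
        g = (q \<otimes>\<^bsub>skew_poly R \<rho>\<^esub> f) \<oplus>\<^bsub>skew_poly R \<rho>\<^esub> q'))"

text \<open>
  The algebra \<open>(D, \<sigma>, d)\<close> with \<open>f = t\<^sup>m - d\<close>, for \<open>m > 0\<close>. As \<open>deg\<close> is \<open>0\<close> at the zero polynomial,
  the carrier contains zero.
\<close>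

definition gen_cyclic_algebra ::
    "('a, 'b) ring_scheme \<Rightarrow> ('a \<Rightarrow> 'a) \<Rightarrow> nat \<Rightarrow> 'a \<Rightarrow> ('a, nat \<Rightarrow> 'a) up_ring" where
  "gen_cyclic_algebra D \<sigma> m d = (skew_poly D \<sigma>)
     \<lparr>carrier := {g \<in> carrier (skew_poly D \<sigma>). deg D g < m},
      mult := \<lambda>g h. skew_rem D \<sigma> (g \<otimes>\<^bsub>skew_poly D \<sigma>\<^esub> h) (skew_binomial D \<sigma> m d)\<rparr>"

definition right_nucleus :: "('a, 'b) monoid_scheme \<Rightarrow> 'a set" where
  "right_nucleus A = {x \<in> carrier A. \<forall>a \<in> carrier A. \<forall>b \<in> carrier A.
     (a \<otimes>\<^bsub>A\<^esub> b) \<otimes>\<^bsub>A\<^esub> x = a \<otimes>\<^bsub>A\<^esub> (b \<otimes>\<^bsub>A\<^esub> x)}"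

text \<open>The substitution \<open>t \<mapsto> t\<^sup>s\<close>, with coefficients kept.\<close>

definition subst_power :: "('a, 'b) ring_scheme \<Rightarrow> nat \<Rightarrow> (nat \<Rightarrow> 'a) \<Rightarrow> nat \<Rightarrow> 'a" where
  "subst_power R s p = (\<lambda>i. if s dvd i then p (i div s) else \<zero>\<^bsub>R\<^esub>)"

end

theory Submission
  imports Defs
begin

text \<open>
  \<^bold>\<open>The nucleus.\<close> Put \<open>f = t\<^sup>m - d\<close>, so that the algebra multiplies two skew polynomials of degree
  less than \<open>m\<close> and takes the remainder modulo the left ideal of multiples \<open>q f\<close>. If \<open>a b = q f + c\<close>
  with \<open>c\<close> the remainder, then \<open>a (b x)\<close> and \<open>(a b) x\<close> in the algebra differ by the remainder of
  \<open>q f x\<close> (\<open>srem_associator\<close>). Hence \<open>x\<close> lies in the right nucleus as soon as \<open>f x\<close> is a left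
  multiple of \<open>f\<close>, and the choice \<open>a = t\<^sup>m\<^sup>-\<^sup>1\<close>, \<open>b = t\<close>, where \<open>q = 1\<close>, shows that this is also
  necessary (\<open>right_nucleus_iff\<close>). When \<open>\<sigma>\<^sup>m\<close> is the identity, \<open>f x - x f\<close> has coefficients
  \<open>x\<^sub>i \<sigma>\<^sup>i(d) - d x\<^sub>i\<close> and therefore degree less than \<open>m\<close>; so \<open>f x\<close> is a left multiple of \<open>f\<close> only if
  \<open>f x = x f\<close>. As \<open>d\<close> is central and \<open>D\<close> has no zero divisors, this says that \<open>x\<^sub>i = 0\<close> unless
  \<open>\<sigma>\<^sup>i(d) = d\<close> (\<open>right_nucleus_support\<close>), and \<open>\<sigma>\<^sup>i(d) = d\<close> means \<open>s dvd i\<close>, where \<open>\<gamma>\<^sup>s\<close> generates the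
  stabilizer of \<open>d\<close>.

  \<^bold>\<open>The quotient.\<close> The substitution \<open>t \<mapsto> t\<^sup>s\<close> embeds the skew polynomials over \<open>\<sigma>\<^sup>s\<close> into those
  over \<open>\<sigma>\<close>, sends \<open>t\<^sup>r - d\<close> to \<open>f\<close>, and is compatible with division. Followed by reduction modulo
  \<open>f\<close> it is a ring homomorphism, because \<open>f\<close> commutes with every polynomial in \<open>t\<^sup>s\<close>; its image is
  the right nucleus and its kernel the ideal generated by \<open>t\<^sup>r - d\<close>. The first isomorphism theorem
  gives \<open>nucleus_iso_quotient\<close>.

  \<^bold>\<open>The field extension.\<close> That \<open>C\<close> has degree \<open>m\<close> over \<open>F\<close> with Galois group generated by \<open>\<gamma>\<close> is
  Artin's theorem for the finite group of the powers of \<open>\<gamma>\<close> (\<open>artin\<close>). It rests on two facts: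
  a homogeneous linear system with more unknowns than equations has a nontrivial solution, and
  distinct automorphisms are linearly independent. More than \<open>m\<close> elements \<open>x\<^sub>j\<close> of \<open>C\<close> are
  dependent over \<open>F\<close>: take a nontrivial solution of the equations \<open>\<Sum>\<^sub>j c\<^sub>j \<tau>(x\<^sub>j) = 0\<close>, scale it so that
  one of the \<open>c\<^sub>j\<close> has nonzero trace, and replace all of them by their traces. Conversely, if \<open>C\<close> is spanned by
  \<open>k\<close> elements over \<open>F\<close>, then more than \<open>k\<close> automorphisms fixing \<open>F\<close> would be linearly dependent.
\<close>

section \<open>Skew polynomial rings\<close>

text \<open>The two ways of summing over the triangle \<open>j + l \<le> k\<close>; this is what associativity comes down to.\<close>

lemma (in abelian_monoid) finsum_triangle:
  fixes k :: nat
  assumes "\<And>i j. f i j \<in> carrier G"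
  shows "(\<Oplus>i\<in>{..k}. \<Oplus>j\<in>{..i}. f j (i - j)) = (\<Oplus>j\<in>{..k}. \<Oplus>l\<in>{..k - j}. f j l)"
proof (induct k)
  case 0
  show ?case using assms by simp
next
  case (Suc k)
  have "(\<Oplus>j\<in>{..Suc k}. \<Oplus>l\<in>{..Suc k - j}. f j l)
      = f (Suc k) 0 \<oplus> (\<Oplus>j\<in>{..k}. \<Oplus>l\<in>{..Suc k - j}. f j l)"
    using assms by simp
  also have "(\<Oplus>j\<in>{..k}. \<Oplus>l\<in>{..Suc k - j}. f j l)
      = (\<Oplus>j\<in>{..k}. f j (Suc k - j) \<oplus> (\<Oplus>l\<in>{..k - j}. f j l))"
    by (rule finsum_cong') (use assms in \<open>auto simp: Suc_diff_le\<close>)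
  also have "\<dots> = (\<Oplus>j\<in>{..k}. f j (Suc k - j)) \<oplus> (\<Oplus>j\<in>{..k}. \<Oplus>l\<in>{..k - j}. f j l)"
    by (rule finsum_addf) (use assms in auto)
  also have "f (Suc k) 0 \<oplus> \<dots>
      = (f (Suc k) 0 \<oplus> (\<Oplus>j\<in>{..k}. f j (Suc k - j))) \<oplus> (\<Oplus>j\<in>{..k}. \<Oplus>l\<in>{..k - j}. f j l)"
    by (rule a_assoc[symmetric]) (use assms in auto)
  also have "f (Suc k) 0 \<oplus> (\<Oplus>j\<in>{..k}. f j (Suc k - j)) = (\<Oplus>j\<in>{..Suc k}. f j (Suc k - j))"
    using assms by simp
  also have "(\<Oplus>j\<in>{..k}. \<Oplus>l\<in>{..k - j}. f j l) = (\<Oplus>i\<in>{..k}. \<Oplus>j\<in>{..i}. f j (i - j))"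
    by (rule Suc[symmetric])
  also have "(\<Oplus>j\<in>{..Suc k}. f j (Suc k - j)) \<oplus> (\<Oplus>i\<in>{..k}. \<Oplus>j\<in>{..i}. f j (i - j))
      = (\<Oplus>i\<in>{..Suc k}. \<Oplus>j\<in>{..i}. f j (i - j))"
    using assms by simp
  finally show ?case by simp
qed

lemma (in abelian_monoid) finsum_single:
  assumes "finite A" "a \<in> A" "\<And>i. i \<in> A \<Longrightarrow> f i \<in> carrier G" "\<And>i. i \<in> A \<Longrightarrow> i \<noteq> a \<Longrightarrow> f i = \<zero>"
  shows "(\<Oplus>i\<in>A. f i) = f a"
proof -
  have "(\<Oplus>i\<in>A. f i) = (\<Oplus>i\<in>A. if a = i then f i else \<zero>)"
    by (rule finsum_cong') (use assms in auto)
  also have "\<dots> = f a"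
    by (rule finsum_singleton) (use assms in auto)
  finally show ?thesis .
qed

text \<open>As the zero polynomial has degree \<open>0\<close>, this would fail for \<open>k = 0\<close>.\<close>

lemma (in ring) deg_less_iff:
  assumes "p \<in> up R" "0 < k"
  shows "deg R p < k \<longleftrightarrow> (\<forall>i\<ge>k. p i = \<zero>)"
proof -
  have U: "UP_ring R" by (rule UP_ring.intro) (rule ring_axioms)
  have c: "up_ring.coeff (UP R) p = p" "p \<in> carrier (UP R)"
    using assms(1) by (simp_all add: UP_def)
  show ?thesis
  proof
    assume "deg R p < k"
    show "\<forall>i\<ge>k. p i = \<zero>"
    proof (intro allI impI)
      fix i assume "k \<le> i"
      with \<open>deg R p < k\<close> have "deg R p < i" by (rule less_le_trans)
      from UP_ring.deg_aboveD[OF U this c(2)] show "p i = \<zero>" unfolding c(1) .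
    qed
  next
    assume z: "\<forall>i\<ge>k. p i = \<zero>"
    have "deg R p \<le> k - 1"
    proof (rule UP_ring.deg_aboveI[OF U _ c(2)])
      fix m assume "k - 1 < m"
      then have "k \<le> m" by simp
      with z show "up_ring.coeff (UP R) p m = \<zero>" unfolding c(1) by blast
    qed
    then show "deg R p < k" using assms(2) by simp
  qed
qed

lemma (in ring) up_boundE:
  assumes "p \<in> up R"
  obtains N where "0 < N" "\<And>i. N \<le> i \<Longrightarrow> p i = \<zero>"
proof -
  obtain n where "bound \<zero> n p" using bound_upD[OF assms] by blast
  then have "\<And>i. Suc n \<le> i \<Longrightarrow> p i = \<zero>" by (auto simp: bound_def)
  then show thesis using that by blast
qed

lemma (in ring) upI:
  assumes "\<And>i. p i \<in> carrier R" "\<And>i. N \<le> i \<Longrightarrow> p i = \<zero>"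
  shows "p \<in> up R"
  using assms unfolding up_def by (auto simp: bound_def intro!: exI[of _ N])

text \<open>
  A ring with an endomorphism \<open>\<rho>\<close>, which need be neither injective nor surjective. The skew
  polynomial ring is \<open>SP\<close>, and \<open>mon a n\<close> is the monomial \<open>a t\<^sup>n\<close>.
\<close>

locale skew_ring = ring R for R (structure) +
  fixes \<rho> :: "'a \<Rightarrow> 'a"
  assumes rho_hom: "\<rho> \<in> ring_hom R R"
begin

abbreviation SP :: "('a, nat \<Rightarrow> 'a) up_ring" where
  "SP \<equiv> skew_poly R \<rho>"

abbreviation mon :: "'a \<Rightarrow> nat \<Rightarrow> nat \<Rightarrow> 'a" where
  "mon \<equiv> up_ring.monom SP"

lemma rho_pow_hom: "\<rho> ^^ i \<in> ring_hom R R"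
  by (induct i) (use ring_hom_memE[OF rho_hom] in \<open>auto intro!: ring_hom_memI simp: ring_hom_memE\<close>)

lemma rho_pow_ring_hom_ring: "ring_hom_ring R R (\<rho> ^^ i)"
  by (rule ring_hom_ringI2[OF ring_axioms ring_axioms rho_pow_hom])

lemma rho_pow [simp]:
  shows "a \<in> carrier R \<Longrightarrow> (\<rho> ^^ i) a \<in> carrier R"
    and "a \<in> carrier R \<Longrightarrow> b \<in> carrier R \<Longrightarrow> (\<rho> ^^ i) (a \<otimes> b) = (\<rho> ^^ i) a \<otimes> (\<rho> ^^ i) b"
    and "a \<in> carrier R \<Longrightarrow> b \<in> carrier R \<Longrightarrow> (\<rho> ^^ i) (a \<oplus> b) = (\<rho> ^^ i) a \<oplus> (\<rho> ^^ i) b"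
    and "(\<rho> ^^ i) \<one> = \<one>" and "(\<rho> ^^ i) \<zero> = \<zero>"
  using ring_hom_memE[OF rho_pow_hom] ring_hom_zero[OF rho_pow_hom ring_axioms ring_axioms] by auto

lemma rho_pow_finsum:
  "finite A \<Longrightarrow> (\<And>x. x \<in> A \<Longrightarrow> f x \<in> carrier R) \<Longrightarrow>
    (\<rho> ^^ i) (\<Oplus>x\<in>A. f x) = (\<Oplus>x\<in>A. (\<rho> ^^ i) (f x))"
  using ring_hom_ring.hom_finsum[OF rho_pow_ring_hom_ring, of f A i] by (auto simp: comp_def)

lemma SP_carrier [simp]: "carrier SP = up R"
  by (simp add: skew_poly_def UP_def)

lemma SP_zero: "\<zero>\<^bsub>SP\<^esub> = (\<lambda>i. \<zero>)"
  by (simp add: skew_poly_def UP_def)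

lemma SP_one: "\<one>\<^bsub>SP\<^esub> = (\<lambda>i. if i = 0 then \<one> else \<zero>)"
  by (simp add: skew_poly_def UP_def)

lemma SP_add: "p \<in> up R \<Longrightarrow> q \<in> up R \<Longrightarrow> p \<oplus>\<^bsub>SP\<^esub> q = (\<lambda>i. p i \<oplus> q i)"
  by (simp add: skew_poly_def UP_def)

lemma SP_mult:
  "p \<in> up R \<Longrightarrow> q \<in> up R \<Longrightarrow> p \<otimes>\<^bsub>SP\<^esub> q = (\<lambda>k. \<Oplus>i\<in>{..k}. p i \<otimes> (\<rho> ^^ i) (q (k - i)))"
  by (simp add: skew_poly_def UP_def)

lemma SP_monom: "a \<in> carrier R \<Longrightarrow> mon a n = (\<lambda>i. if i = n then a else \<zero>)"
  by (simp add: skew_poly_def UP_def)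

lemma up_closed [simp]: "p \<in> up R \<Longrightarrow> p i \<in> carrier R"
  by (rule mem_upD)

lemma mon_closed [simp]: "a \<in> carrier R \<Longrightarrow> mon a n \<in> up R"
  by (auto simp: SP_monom intro: upI[where N = "Suc n"])

lemma SP_mult_closed [simp]:
  assumes "p \<in> up R" "q \<in> up R"
  shows "p \<otimes>\<^bsub>SP\<^esub> q \<in> up R"
proof -
  obtain M where M: "\<And>i. M \<le> i \<Longrightarrow> p i = \<zero>" using up_boundE[OF assms(1)] by blast
  obtain N where N: "\<And>i. N \<le> i \<Longrightarrow> q i = \<zero>" using up_boundE[OF assms(2)] by blast
  have "(\<Oplus>i\<in>{..k}. p i \<otimes> (\<rho> ^^ i) (q (k - i))) = \<zero>" if "M + N \<le> k" for k
  proof -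
    have "p i \<otimes> (\<rho> ^^ i) (q (k - i)) = \<zero>" for i
      using M[of i] N[of "k - i"] that assms by (cases "M \<le> i") auto
    then show ?thesis by simp
  qed
  then show ?thesis
    unfolding SP_mult[OF assms]
    by (intro upI[where N = "M + N"]) (use assms in auto)
qed

lemma SP_mult_assoc:
  assumes "p \<in> up R" "q \<in> up R" "r \<in> up R"
  shows "p \<otimes>\<^bsub>SP\<^esub> q \<otimes>\<^bsub>SP\<^esub> r = p \<otimes>\<^bsub>SP\<^esub> (q \<otimes>\<^bsub>SP\<^esub> r)"
proof
  fix k
  define f where "f j l = p j \<otimes> (\<rho> ^^ j) (q l) \<otimes> (\<rho> ^^ (j + l)) (r (k - (j + l)))" for j l
  have f: "f j l \<in> carrier R" for j l
    using assms by (simp add: f_def)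
  have "(p \<otimes>\<^bsub>SP\<^esub> q \<otimes>\<^bsub>SP\<^esub> r) k
      = (\<Oplus>i\<in>{..k}. (\<Oplus>j\<in>{..i}. p j \<otimes> (\<rho> ^^ j) (q (i - j))) \<otimes> (\<rho> ^^ i) (r (k - i)))"
    using assms SP_mult_closed by (simp add: SP_mult)
  also have "\<dots> = (\<Oplus>i\<in>{..k}. \<Oplus>j\<in>{..i}. f j (i - j))"
  proof (rule finsum_cong'[OF refl])
    show "(\<lambda>i. \<Oplus>j\<in>{..i}. f j (i - j)) \<in> {..k} \<rightarrow> carrier R" using f by auto
    fix i assume "i \<in> {..k}"
    have "(\<Oplus>j\<in>{..i}. p j \<otimes> (\<rho> ^^ j) (q (i - j))) \<otimes> (\<rho> ^^ i) (r (k - i))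
       = (\<Oplus>j\<in>{..i}. p j \<otimes> (\<rho> ^^ j) (q (i - j)) \<otimes> (\<rho> ^^ i) (r (k - i)))"
      by (rule finsum_ldistr) (use assms in auto)
    also have "\<dots> = (\<Oplus>j\<in>{..i}. f j (i - j))"
      by (rule finsum_cong') (use assms f in \<open>auto simp: f_def\<close>)
    finally show "(\<Oplus>j\<in>{..i}. p j \<otimes> (\<rho> ^^ j) (q (i - j))) \<otimes> (\<rho> ^^ i) (r (k - i))
       = (\<Oplus>j\<in>{..i}. f j (i - j))" .
  qed
  also have "\<dots> = (\<Oplus>j\<in>{..k}. \<Oplus>l\<in>{..k - j}. f j l)"
    by (rule finsum_triangle) (rule f)
  also have "\<dots> = (\<Oplus>j\<in>{..k}. p j \<otimes> (\<rho> ^^ j) (\<Oplus>l\<in>{..k - j}. q l \<otimes> (\<rho> ^^ l) (r (k - j - l))))"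
  proof (rule finsum_cong'[OF refl])
    show "(\<lambda>j. p j \<otimes> (\<rho> ^^ j) (\<Oplus>l\<in>{..k - j}. q l \<otimes> (\<rho> ^^ l) (r (k - j - l)))) \<in> {..k} \<rightarrow> carrier R"
      using assms by auto
    fix j assume "j \<in> {..k}"
    have "p j \<otimes> (\<rho> ^^ j) (\<Oplus>l\<in>{..k - j}. q l \<otimes> (\<rho> ^^ l) (r (k - j - l)))
        = p j \<otimes> (\<Oplus>l\<in>{..k - j}. (\<rho> ^^ j) (q l \<otimes> (\<rho> ^^ l) (r (k - j - l))))"
      using assms by (subst rho_pow_finsum) auto
    also have "\<dots> = (\<Oplus>l\<in>{..k - j}. p j \<otimes> (\<rho> ^^ j) (q l \<otimes> (\<rho> ^^ l) (r (k - j - l))))"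
      by (rule finsum_rdistr) (use assms in auto)
    also have "\<dots> = (\<Oplus>l\<in>{..k - j}. f j l)"
      by (rule finsum_cong') (use assms f in \<open>auto simp: f_def m_assoc funpow_add\<close>)
    finally show "(\<Oplus>l\<in>{..k - j}. f j l)
        = p j \<otimes> (\<rho> ^^ j) (\<Oplus>l\<in>{..k - j}. q l \<otimes> (\<rho> ^^ l) (r (k - j - l)))" by simp
  qed
  also have "\<dots> = (p \<otimes>\<^bsub>SP\<^esub> (q \<otimes>\<^bsub>SP\<^esub> r)) k"
    using assms SP_mult_closed by (simp add: SP_mult)
  finally show "(p \<otimes>\<^bsub>SP\<^esub> q \<otimes>\<^bsub>SP\<^esub> r) k = (p \<otimes>\<^bsub>SP\<^esub> (q \<otimes>\<^bsub>SP\<^esub> r)) k" .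
qed

lemma mon_mult:
  assumes "a \<in> carrier R" "q \<in> up R"
  shows "(mon a n \<otimes>\<^bsub>SP\<^esub> q) k = (if n \<le> k then a \<otimes> (\<rho> ^^ n) (q (k - n)) else \<zero>)"
proof (cases "n \<le> k")
  case True
  have "(mon a n \<otimes>\<^bsub>SP\<^esub> q) k = (\<Oplus>i\<in>{..k}. mon a n i \<otimes> (\<rho> ^^ i) (q (k - i)))"
    using assms by (simp add: SP_mult)
  also have "\<dots> = mon a n n \<otimes> (\<rho> ^^ n) (q (k - n))"
    using True assms by (intro finsum_single) (auto simp: SP_monom)
  finally show ?thesis using True assms by (simp add: SP_monom)
next
  case False
  have "(mon a n \<otimes>\<^bsub>SP\<^esub> q) k = (\<Oplus>i\<in>{..k}. mon a n i \<otimes> (\<rho> ^^ i) (q (k - i)))"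
    using assms by (simp add: SP_mult)
  also have "\<dots> = (\<Oplus>i\<in>{..k}. \<zero>)"
    by (rule finsum_cong') (use False assms in \<open>auto simp: SP_monom\<close>)
  finally show ?thesis using False by simp
qed

lemma mult_mon:
  assumes "b \<in> carrier R" "p \<in> up R"
  shows "(p \<otimes>\<^bsub>SP\<^esub> mon b n) k = (if n \<le> k then p (k - n) \<otimes> (\<rho> ^^ (k - n)) b else \<zero>)"
proof (cases "n \<le> k")
  case True
  have "(p \<otimes>\<^bsub>SP\<^esub> mon b n) k = (\<Oplus>i\<in>{..k}. p i \<otimes> (\<rho> ^^ i) (mon b n (k - i)))"
    using assms by (simp add: SP_mult)
  also have "\<dots> = p (k - n) \<otimes> (\<rho> ^^ (k - n)) (mon b n (k - (k - n)))"
    using True assms by (intro finsum_single) (auto simp: SP_monom)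
  finally show ?thesis using True assms by (simp add: SP_monom)
next
  case False
  have "(p \<otimes>\<^bsub>SP\<^esub> mon b n) k = (\<Oplus>i\<in>{..k}. p i \<otimes> (\<rho> ^^ i) (mon b n (k - i)))"
    using assms by (simp add: SP_mult)
  also have "\<dots> = (\<Oplus>i\<in>{..k}. \<zero>)"
    by (rule finsum_cong') (use False assms in \<open>auto simp: SP_monom\<close>)
  finally show ?thesis using False by simp
qed

lemma SP_one_mon: "\<one>\<^bsub>SP\<^esub> = mon \<one> 0"
  by (simp add: SP_one SP_monom)

lemma SP_ring: "ring SP"
proof (rule ringI)
  show "abelian_group SP"
  proof (rule abelian_groupI)
    fix x assume x: "x \<in> carrier SP"
    show "\<exists>y\<in>carrier SP. y \<oplus>\<^bsub>SP\<^esub> x = \<zero>\<^bsub>SP\<^esub>"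
    proof (rule bexI)
      show "(\<lambda>i. \<ominus> x i) \<in> carrier SP" using x up_a_inv_closed by simp
      then show "(\<lambda>i. \<ominus> x i) \<oplus>\<^bsub>SP\<^esub> x = \<zero>\<^bsub>SP\<^esub>"
        using x by (simp add: SP_add SP_zero l_neg)
    qed
  next
    show "\<zero>\<^bsub>SP\<^esub> \<in> carrier SP" by (auto simp: SP_zero intro: upI)
    then show "\<zero>\<^bsub>SP\<^esub> \<oplus>\<^bsub>SP\<^esub> x = x" if "x \<in> carrier SP" for x
      using that by (simp add: SP_add SP_zero)
  qed (auto simp: SP_add up_add_closed a_ac)
  show "monoid SP"
  proof (rule monoidI)
    fix x assume "x \<in> carrier SP"
    then show "\<one>\<^bsub>SP\<^esub> \<otimes>\<^bsub>SP\<^esub> x = x" "x \<otimes>\<^bsub>SP\<^esub> \<one>\<^bsub>SP\<^esub> = x"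
      unfolding SP_one_mon by (auto simp: mon_mult mult_mon)
  qed (auto simp: SP_mult_closed SP_mult_assoc SP_one_mon)
next
  fix x y z assume "x \<in> carrier SP" "y \<in> carrier SP" "z \<in> carrier SP"
  then have X: "x \<in> up R" "y \<in> up R" "z \<in> up R" by auto
  show "(x \<oplus>\<^bsub>SP\<^esub> y) \<otimes>\<^bsub>SP\<^esub> z = x \<otimes>\<^bsub>SP\<^esub> z \<oplus>\<^bsub>SP\<^esub> y \<otimes>\<^bsub>SP\<^esub> z"
  proof
    fix k
    have "(\<Oplus>i\<in>{..k}. (x i \<oplus> y i) \<otimes> (\<rho> ^^ i) (z (k - i)))
       = (\<Oplus>i\<in>{..k}. x i \<otimes> (\<rho> ^^ i) (z (k - i)) \<oplus> y i \<otimes> (\<rho> ^^ i) (z (k - i)))"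
      by (rule finsum_cong') (use X in \<open>auto simp: l_distr\<close>)
    then show "((x \<oplus>\<^bsub>SP\<^esub> y) \<otimes>\<^bsub>SP\<^esub> z) k = (x \<otimes>\<^bsub>SP\<^esub> z \<oplus>\<^bsub>SP\<^esub> y \<otimes>\<^bsub>SP\<^esub> z) k"
      using X by (simp add: SP_add SP_mult_closed up_add_closed) (simp add: SP_mult up_add_closed finsum_addf Pi_def)
  qed
  show "z \<otimes>\<^bsub>SP\<^esub> (x \<oplus>\<^bsub>SP\<^esub> y) = z \<otimes>\<^bsub>SP\<^esub> x \<oplus>\<^bsub>SP\<^esub> z \<otimes>\<^bsub>SP\<^esub> y"
  proof
    fix k
    have "(\<Oplus>i\<in>{..k}. z i \<otimes> (\<rho> ^^ i) (x (k - i) \<oplus> y (k - i)))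
       = (\<Oplus>i\<in>{..k}. z i \<otimes> (\<rho> ^^ i) (x (k - i)) \<oplus> z i \<otimes> (\<rho> ^^ i) (y (k - i)))"
      by (rule finsum_cong') (use X in \<open>auto simp: r_distr\<close>)
    then show "(z \<otimes>\<^bsub>SP\<^esub> (x \<oplus>\<^bsub>SP\<^esub> y)) k = (z \<otimes>\<^bsub>SP\<^esub> x \<oplus>\<^bsub>SP\<^esub> z \<otimes>\<^bsub>SP\<^esub> y) k"
      using X by (simp add: SP_add SP_mult_closed up_add_closed) (simp add: SP_mult up_add_closed finsum_addf Pi_def)
  qed
qed

sublocale P: ring SP
  by (rule SP_ring)

lemma SP_closed [simp]:
  shows "\<zero>\<^bsub>SP\<^esub> \<in> up R" and "\<one>\<^bsub>SP\<^esub> \<in> up R"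
    and "p \<in> up R \<Longrightarrow> q \<in> up R \<Longrightarrow> p \<oplus>\<^bsub>SP\<^esub> q \<in> up R"
    and "p \<in> up R \<Longrightarrow> q \<in> up R \<Longrightarrow> p \<ominus>\<^bsub>SP\<^esub> q \<in> up R"
    and "p \<in> up R \<Longrightarrow> \<ominus>\<^bsub>SP\<^esub> p \<in> up R"
  using P.zero_closed P.one_closed P.a_closed P.minus_closed P.a_inv_closed by auto

lemma SP_zero_coeff: "\<zero>\<^bsub>SP\<^esub> i = \<zero>"
  by (simp add: SP_zero)

lemma SP_coeff [simp]:
  shows "\<one>\<^bsub>SP\<^esub> i = (if i = 0 then \<one> else \<zero>)"
    and "a \<in> carrier R \<Longrightarrow> mon a n i = (if i = n then a else \<zero>)"
    and "p \<in> up R \<Longrightarrow> q \<in> up R \<Longrightarrow> (p \<oplus>\<^bsub>SP\<^esub> q) i = p i \<oplus> q i"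
  by (simp_all add: SP_one SP_monom SP_add)

lemma SP_minus_coeff [simp]:
  assumes "p \<in> up R" "q \<in> up R"
  shows "(p \<ominus>\<^bsub>SP\<^esub> q) i = p i \<ominus> q i"
proof -
  have "(p \<ominus>\<^bsub>SP\<^esub> q) \<oplus>\<^bsub>SP\<^esub> q = p"
    using assms by (simp add: P.minus_eq P.a_assoc P.l_neg)
  then have "(p \<ominus>\<^bsub>SP\<^esub> q) i \<oplus> q i = p i"
    using assms by (metis SP_coeff(3) SP_closed(4))
  then show ?thesis
    using add.inv_solve_right[of "(p \<ominus>\<^bsub>SP\<^esub> q) i" "p i" "q i"] assms by (simp add: minus_eq)
qed

end

section \<open>Division by a binomial\<close>

lemma (in abelian_group) minus_eq_minusI:
  assumes "a \<in> carrier G" "b \<in> carrier G" "r \<in> carrier G" "r' \<in> carrier G"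
    and "a \<oplus> r = b \<oplus> r'"
  shows "a \<ominus> b = r' \<ominus> r"
proof -
  have "(a \<ominus> b) \<oplus> (b \<oplus> r) = a \<oplus> r"
    using assms(1-4) by (simp add: minus_eq a_assoc r_neg1)
  moreover have "(r' \<ominus> r) \<oplus> (b \<oplus> r) = b \<oplus> r'"
    using assms(1-4) by (simp add: minus_eq a_assoc a_comm[of b r] r_neg1 a_comm[of r' b])
  ultimately have "(a \<ominus> b) \<oplus> (b \<oplus> r) = (r' \<ominus> r) \<oplus> (b \<oplus> r)"
    using assms(5) by simp
  then show ?thesis
    using assms(1-4) by simp
qed

text \<open>
  Division on the right by the monic polynomial \<open>binom = t\<^sup>k - d\<close> of positive degree. The remainder
  of \<open>g\<close> is \<open>srem g\<close>, the polynomials of degree less than \<open>k\<close> are those with \<open>low\<close>, and \<open>alg\<close> is the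
  algebra of remainders.
\<close>

locale skew_binom = skew_ring R \<rho> for R (structure) and \<rho> +
  fixes k :: nat and d
  assumes k_pos: "0 < k" and d_closed [simp]: "d \<in> carrier R" and one_not_zero: "\<one> \<noteq> \<zero>"
begin

abbreviation binom :: "nat \<Rightarrow> 'a" where
  "binom \<equiv> skew_binomial R \<rho> k d"

abbreviation srem :: "(nat \<Rightarrow> 'a) \<Rightarrow> nat \<Rightarrow> 'a" where
  "srem g \<equiv> skew_rem R \<rho> g binom"

abbreviation low :: "(nat \<Rightarrow> 'a) \<Rightarrow> bool" where
  "low p \<equiv> \<forall>i\<ge>k. p i = \<zero>"

abbreviation alg :: "('a, nat \<Rightarrow> 'a) up_ring" where
  "alg \<equiv> gen_cyclic_algebra R \<rho> k d"

lemma binom_closed [simp]: "binom \<in> up R"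
  by (simp add: skew_binomial_def)

lemma mult_binom:
  assumes "h \<in> up R"
  shows "(h \<otimes>\<^bsub>SP\<^esub> binom) i = (if k \<le> i then h (i - k) else \<zero>) \<ominus> h i \<otimes> (\<rho> ^^ i) d"
proof -
  have "h \<otimes>\<^bsub>SP\<^esub> binom = h \<otimes>\<^bsub>SP\<^esub> mon \<one> k \<ominus>\<^bsub>SP\<^esub> h \<otimes>\<^bsub>SP\<^esub> mon d 0"
    unfolding skew_binomial_def P.minus_eq
    by (simp add: assms P.r_distr P.r_minus)
  then show ?thesis
    using assms by (simp add: mult_mon)
qed

lemma binom_mult:
  assumes "h \<in> up R"
  shows "(binom \<otimes>\<^bsub>SP\<^esub> h) i = (if k \<le> i then (\<rho> ^^ k) (h (i - k)) else \<zero>) \<ominus> d \<otimes> h i"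
proof -
  have "binom \<otimes>\<^bsub>SP\<^esub> h = mon \<one> k \<otimes>\<^bsub>SP\<^esub> h \<ominus>\<^bsub>SP\<^esub> mon d 0 \<otimes>\<^bsub>SP\<^esub> h"
    unfolding skew_binomial_def P.minus_eq
    by (simp add: assms P.l_distr P.l_minus)
  then show ?thesis
    using assms by (simp add: mon_mult)
qed

lemma minus_zero_right [simp]: "a \<in> carrier R \<Longrightarrow> a \<ominus> \<zero> = a"
  by (simp add: minus_eq)

lemma deg_binom: "deg R binom = k"
proof -
  have b: "binom i = (if i = k then \<one> else \<zero>) \<ominus> (if i = 0 then d else \<zero>)" for i
    unfolding skew_binomial_def using k_pos by simp
  have "deg R binom < Suc k"
    using k_pos by (subst deg_less_iff) (auto simp: b)
  moreover have "\<not> deg R binom < k"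
    using k_pos one_not_zero by (subst deg_less_iff) (auto simp: b intro!: exI[of _ k])
  ultimately show ?thesis by simp
qed

text \<open>
  If the coefficients of \<open>h (t\<^sup>k - d)\<close> of index at least \<open>k\<close> vanish, then
  \<open>h\<^sub>j = h\<^sub>j\<^sub>+\<^sub>k \<rho>\<^sup>j\<^sup>+\<^sup>k(d)\<close> for all \<open>j\<close>, and \<open>h = 0\<close> because almost all \<open>h\<^sub>j\<close> are zero.
\<close>

lemma low_mult_binom_zero:
  assumes "h \<in> up R" "low (h \<otimes>\<^bsub>SP\<^esub> binom)"
  shows "h = \<zero>\<^bsub>SP\<^esub>"
proof -
  obtain N where N: "\<And>i. N \<le> i \<Longrightarrow> h i = \<zero>" using up_boundE[OF assms(1)] by blast
  have "\<forall>j. N \<le> j + n \<longrightarrow> h j = \<zero>" for n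
  proof (induct n)
    case 0
    show ?case using N by simp
  next
    case (Suc n)
    show ?case
    proof (intro allI impI)
      fix j assume "N \<le> j + Suc n"
      then have "h (j + k) = \<zero>" using Suc k_pos by simp
      moreover have "(h \<otimes>\<^bsub>SP\<^esub> binom) (j + k) = \<zero>" using assms(2) by simp
      ultimately show "h j = \<zero>" using assms(1) by (simp add: mult_binom)
    qed
  qed
  then have "h j = \<zero>" for j by (meson le_add2)
  then show ?thesis by (auto simp: SP_zero)
qed

lemma division_exists:
  assumes "g \<in> up R"
  shows "\<exists>q\<in>up R. \<exists>r\<in>up R. low r \<and> g = q \<otimes>\<^bsub>SP\<^esub> binom \<oplus>\<^bsub>SP\<^esub> r"
proof -
  have *: "g \<in> up R \<Longrightarrow> \<forall>i\<ge>N. g i = \<zero> \<Longrightarrow>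
      \<exists>q\<in>up R. \<exists>r\<in>up R. low r \<and> g = q \<otimes>\<^bsub>SP\<^esub> binom \<oplus>\<^bsub>SP\<^esub> r" for N g
  proof (induct N arbitrary: g)
    case 0
    have z: "\<zero>\<^bsub>SP\<^esub> \<in> up R" using P.zero_closed by simp
    have "g = \<zero>\<^bsub>SP\<^esub> \<otimes>\<^bsub>SP\<^esub> binom \<oplus>\<^bsub>SP\<^esub> g"
      using 0(1) by simp
    moreover have "low g" using 0(2) by simp
    ultimately show ?case using z 0(1) by blast
  next
    case (Suc N)
    show ?case
    proof (cases "N < k")
      case True
      have z: "\<zero>\<^bsub>SP\<^esub> \<in> up R" using P.zero_closed by simp
      have "g = \<zero>\<^bsub>SP\<^esub> \<otimes>\<^bsub>SP\<^esub> binom \<oplus>\<^bsub>SP\<^esub> g"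
        using Suc(2) by simp
      moreover have "low g" using Suc(3) True by simp
      ultimately show ?thesis using z Suc(2) by blast
    next
      case False
      \<comment> \<open>Cancel the top coefficient; the only other coefficient affected is that at \<open>N - k\<close>.\<close>
      define q0 where "q0 = mon (g N) (N - k)"
      have q0: "q0 \<in> up R" and q0': "q0 i = (if i = N - k then g N else \<zero>)" for i
        using Suc(2) by (simp_all add: q0_def)
      define g1 where "g1 = g \<ominus>\<^bsub>SP\<^esub> q0 \<otimes>\<^bsub>SP\<^esub> binom"
      have g1: "g1 \<in> up R"
        using Suc(2) q0 P.minus_closed[of g "q0 \<otimes>\<^bsub>SP\<^esub> binom"]
        by (simp add: g1_def SP_mult_closed)
      have g1': "g1 i = g i \<ominus> ((if k \<le> i then q0 (i - k) else \<zero>) \<ominus> q0 i \<otimes> (\<rho> ^^ i) d)" for i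
        using Suc(2) q0 by (simp add: g1_def SP_mult_closed mult_binom)
      have "g1 i = \<zero>" if "N \<le> i" for i
        using that False k_pos Suc(2,3) unfolding g1' q0' by (cases "i = N") (auto simp: minus_eq r_neg)
      then obtain q r where qr: "q \<in> up R" "r \<in> up R" "low r" "g1 = q \<otimes>\<^bsub>SP\<^esub> binom \<oplus>\<^bsub>SP\<^esub> r"
        using Suc(1)[OF g1] by blast
      have "g = q0 \<otimes>\<^bsub>SP\<^esub> binom \<oplus>\<^bsub>SP\<^esub> g1"
        using Suc(2) q0 unfolding g1_def P.minus_eq
        by (simp add: P.a_lcomm P.r_neg)
      also have "\<dots> = (q0 \<oplus>\<^bsub>SP\<^esub> q) \<otimes>\<^bsub>SP\<^esub> binom \<oplus>\<^bsub>SP\<^esub> r"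
        using q0 qr by (simp add: P.l_distr P.a_assoc)
      finally show ?thesis
        using qr q0 P.a_closed[of q0 q] by (metis SP_carrier)
    qed
  qed
  show ?thesis using up_boundE[OF assms] *[OF assms] by metis
qed

lemma division_unique:
  assumes "q \<in> up R" "r \<in> up R" "low r" "q' \<in> up R" "r' \<in> up R" "low r'"
    and eq: "q \<otimes>\<^bsub>SP\<^esub> binom \<oplus>\<^bsub>SP\<^esub> r = q' \<otimes>\<^bsub>SP\<^esub> binom \<oplus>\<^bsub>SP\<^esub> r'"
  shows "r = r'"
proof -
  have c: "q \<ominus>\<^bsub>SP\<^esub> q' \<in> up R" "r' \<ominus>\<^bsub>SP\<^esub> r \<in> up R"
    using assms(1,2,4,5) P.minus_closed[of q q'] P.minus_closed[of r' r] by auto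
  have "(q \<ominus>\<^bsub>SP\<^esub> q') \<otimes>\<^bsub>SP\<^esub> binom = q \<otimes>\<^bsub>SP\<^esub> binom \<ominus>\<^bsub>SP\<^esub> q' \<otimes>\<^bsub>SP\<^esub> binom"
    using assms(1,4) by (simp add: P.minus_eq P.l_distr P.l_minus)
  also have "\<dots> = r' \<ominus>\<^bsub>SP\<^esub> r"
    using assms(1,2,4,5) eq by (intro P.minus_eq_minusI) auto
  finally have e: "(q \<ominus>\<^bsub>SP\<^esub> q') \<otimes>\<^bsub>SP\<^esub> binom = r' \<ominus>\<^bsub>SP\<^esub> r" .
  have "low (r' \<ominus>\<^bsub>SP\<^esub> r)" using assms(2,3,5,6) by simp
  then have "q \<ominus>\<^bsub>SP\<^esub> q' = \<zero>\<^bsub>SP\<^esub>"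
    using low_mult_binom_zero[OF c(1)] e by simp
  then have "r' \<ominus>\<^bsub>SP\<^esub> r = \<zero>\<^bsub>SP\<^esub>"
    using e by simp
  then show ?thesis
    using assms(2,5) P.r_right_minus_eq by simp
qed

lemma srem_eqI:
  assumes "q \<in> up R" "r \<in> up R" "low r"
  shows "srem (q \<otimes>\<^bsub>SP\<^esub> binom \<oplus>\<^bsub>SP\<^esub> r) = r"
  unfolding skew_rem_def deg_binom
proof (rule the_equality)
  show "r \<in> carrier SP \<and> deg R r < k \<and>
    (\<exists>qa\<in>carrier SP. q \<otimes>\<^bsub>SP\<^esub> binom \<oplus>\<^bsub>SP\<^esub> r = qa \<otimes>\<^bsub>SP\<^esub> binom \<oplus>\<^bsub>SP\<^esub> r)"
    using assms k_pos deg_less_iff by auto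
  fix r' assume "r' \<in> carrier SP \<and> deg R r' < k \<and>
    (\<exists>qa\<in>carrier SP. q \<otimes>\<^bsub>SP\<^esub> binom \<oplus>\<^bsub>SP\<^esub> r = qa \<otimes>\<^bsub>SP\<^esub> binom \<oplus>\<^bsub>SP\<^esub> r')"
  then show "r' = r"
    using assms division_unique[of q r _ r'] deg_less_iff[of r' k] k_pos by (metis SP_carrier)
qed

lemma srem:
  assumes "g \<in> up R"
  shows "srem g \<in> up R" and "low (srem g)"
    and "\<exists>q\<in>up R. g = q \<otimes>\<^bsub>SP\<^esub> binom \<oplus>\<^bsub>SP\<^esub> srem g"
proof -
  obtain q r where qr: "q \<in> up R" "r \<in> up R" "low r" "g = q \<otimes>\<^bsub>SP\<^esub> binom \<oplus>\<^bsub>SP\<^esub> r"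
    using division_exists[OF assms] by blast
  have "srem g = r" unfolding qr(4) by (rule srem_eqI[OF qr(1-3)])
  then show "srem g \<in> up R" "low (srem g)" "\<exists>q\<in>up R. g = q \<otimes>\<^bsub>SP\<^esub> binom \<oplus>\<^bsub>SP\<^esub> srem g"
    using qr by auto
qed

lemma srem_mult_binom:
  assumes "q \<in> up R"
  shows "srem (q \<otimes>\<^bsub>SP\<^esub> binom) = \<zero>\<^bsub>SP\<^esub>"
proof -
  have "srem (q \<otimes>\<^bsub>SP\<^esub> binom \<oplus>\<^bsub>SP\<^esub> \<zero>\<^bsub>SP\<^esub>) = \<zero>\<^bsub>SP\<^esub>"
    by (rule srem_eqI) (use assms in \<open>auto simp: SP_zero_coeff\<close>)
  then show ?thesis using assms by simp
qed

lemma srem_low: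
  assumes "r \<in> up R" "low r"
  shows "srem r = r"
proof -
  have "\<zero>\<^bsub>SP\<^esub> \<otimes>\<^bsub>SP\<^esub> binom \<oplus>\<^bsub>SP\<^esub> r = r"
    using assms by simp
  then show ?thesis
    using srem_eqI[OF _ assms, of "\<zero>\<^bsub>SP\<^esub>"] P.zero_closed by simp
qed

lemma srem_add:
  assumes "g \<in> up R" "h \<in> up R"
  shows "srem (g \<oplus>\<^bsub>SP\<^esub> h) = srem g \<oplus>\<^bsub>SP\<^esub> srem h"
proof -
  obtain q where q: "q \<in> up R" "g = q \<otimes>\<^bsub>SP\<^esub> binom \<oplus>\<^bsub>SP\<^esub> srem g"
    using srem(3)[OF assms(1)] by (elim bexE) (rule that)
  obtain q' where q': "q' \<in> up R" "h = q' \<otimes>\<^bsub>SP\<^esub> binom \<oplus>\<^bsub>SP\<^esub> srem h"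
    using srem(3)[OF assms(2)] by (elim bexE) (rule that)
  note c = srem(1)[OF assms(1)] srem(1)[OF assms(2)]
  have "g \<oplus>\<^bsub>SP\<^esub> h = (q \<otimes>\<^bsub>SP\<^esub> binom \<oplus>\<^bsub>SP\<^esub> srem g) \<oplus>\<^bsub>SP\<^esub> (q' \<otimes>\<^bsub>SP\<^esub> binom \<oplus>\<^bsub>SP\<^esub> srem h)"
    by (rule arg_cong2[OF q(2) q'(2)])
  also have "\<dots> = (q \<oplus>\<^bsub>SP\<^esub> q') \<otimes>\<^bsub>SP\<^esub> binom \<oplus>\<^bsub>SP\<^esub> (srem g \<oplus>\<^bsub>SP\<^esub> srem h)"
    using q(1) q'(1) c by (simp add: P.l_distr P.a_ac)
  finally have "srem (g \<oplus>\<^bsub>SP\<^esub> h)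
      = srem ((q \<oplus>\<^bsub>SP\<^esub> q') \<otimes>\<^bsub>SP\<^esub> binom \<oplus>\<^bsub>SP\<^esub> (srem g \<oplus>\<^bsub>SP\<^esub> srem h))"
    by (rule arg_cong)
  also have "\<dots> = srem g \<oplus>\<^bsub>SP\<^esub> srem h"
    using q(1) q'(1) c srem(2)[OF assms(1)] srem(2)[OF assms(2)] up_add_closed
    by (intro srem_eqI) auto
  finally show ?thesis .
qed

lemma srem_eq_zero_iff:
  assumes "g \<in> up R"
  shows "srem g = \<zero>\<^bsub>SP\<^esub> \<longleftrightarrow> (\<exists>q\<in>up R. g = q \<otimes>\<^bsub>SP\<^esub> binom)"
proof
  assume z: "srem g = \<zero>\<^bsub>SP\<^esub>"
  obtain q where q: "q \<in> up R" "g = q \<otimes>\<^bsub>SP\<^esub> binom \<oplus>\<^bsub>SP\<^esub> srem g"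
    using srem(3)[OF assms] by (elim bexE) (rule that)
  have "q \<otimes>\<^bsub>SP\<^esub> binom \<oplus>\<^bsub>SP\<^esub> srem g = q \<otimes>\<^bsub>SP\<^esub> binom"
    by (subst z) (use q(1) in simp)
  from q(2) this have "g = q \<otimes>\<^bsub>SP\<^esub> binom" by (rule trans)
  then show "\<exists>q\<in>up R. g = q \<otimes>\<^bsub>SP\<^esub> binom" using q(1) by (rule bexI)
next
  assume "\<exists>q\<in>up R. g = q \<otimes>\<^bsub>SP\<^esub> binom"
  then show "srem g = \<zero>\<^bsub>SP\<^esub>" using srem_mult_binom by auto
qed

lemma srem_mult_srem:
  assumes "a \<in> up R" "b \<in> up R"
  shows "srem (a \<otimes>\<^bsub>SP\<^esub> srem b) = srem (a \<otimes>\<^bsub>SP\<^esub> b)"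
proof -
  obtain q where q: "q \<in> up R" "b = q \<otimes>\<^bsub>SP\<^esub> binom \<oplus>\<^bsub>SP\<^esub> srem b"
    using srem(3)[OF assms(2)] by (elim bexE) (rule that)
  note c = srem(1)[OF assms(2)]
  have "a \<otimes>\<^bsub>SP\<^esub> b = a \<otimes>\<^bsub>SP\<^esub> (q \<otimes>\<^bsub>SP\<^esub> binom \<oplus>\<^bsub>SP\<^esub> srem b)"
    by (rule arg_cong[OF q(2)])
  also have "\<dots> = a \<otimes>\<^bsub>SP\<^esub> q \<otimes>\<^bsub>SP\<^esub> binom \<oplus>\<^bsub>SP\<^esub> a \<otimes>\<^bsub>SP\<^esub> srem b"
    using assms q(1) c by (simp add: P.r_distr P.m_assoc)
  finally have "srem (a \<otimes>\<^bsub>SP\<^esub> b)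
      = srem (a \<otimes>\<^bsub>SP\<^esub> q \<otimes>\<^bsub>SP\<^esub> binom \<oplus>\<^bsub>SP\<^esub> a \<otimes>\<^bsub>SP\<^esub> srem b)"
    by (rule arg_cong)
  also have "\<dots> = srem (a \<otimes>\<^bsub>SP\<^esub> q \<otimes>\<^bsub>SP\<^esub> binom) \<oplus>\<^bsub>SP\<^esub> srem (a \<otimes>\<^bsub>SP\<^esub> srem b)"
    using assms q(1) c by (intro srem_add) (auto intro!: SP_mult_closed)
  also have "srem (a \<otimes>\<^bsub>SP\<^esub> q \<otimes>\<^bsub>SP\<^esub> binom) = \<zero>\<^bsub>SP\<^esub>"
    using assms q(1) by (intro srem_mult_binom SP_mult_closed)
  finally show ?thesis
    using assms c srem(1)[of "a \<otimes>\<^bsub>SP\<^esub> srem b"] by simp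
qed

section \<open>The right nucleus\<close>

lemma alg_carrier: "carrier alg = {g \<in> up R. low g}"
  using deg_less_iff[OF _ k_pos] by (auto simp: gen_cyclic_algebra_def)

lemma alg_mult: "g \<otimes>\<^bsub>alg\<^esub> h = srem (g \<otimes>\<^bsub>SP\<^esub> h)"
  by (simp add: gen_cyclic_algebra_def)

lemma alg_simps [simp]:
  "add alg = add SP" "\<zero>\<^bsub>alg\<^esub> = \<zero>\<^bsub>SP\<^esub>" "\<one>\<^bsub>alg\<^esub> = \<one>\<^bsub>SP\<^esub>" "up_ring.monom alg = mon"
  by (simp_all add: gen_cyclic_algebra_def)

text \<open>
  In the algebra, \<open>a (b x) - (a b) x\<close> is the remainder of \<open>q (t\<^sup>k - d) x\<close>, where \<open>q\<close> is the quotient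
  of \<open>a b\<close>.
\<close>

lemma srem_associator:
  assumes "a \<in> up R" "b \<in> up R" "x \<in> up R" "q \<in> up R"
    and "a \<otimes>\<^bsub>SP\<^esub> b = q \<otimes>\<^bsub>SP\<^esub> binom \<oplus>\<^bsub>SP\<^esub> srem (a \<otimes>\<^bsub>SP\<^esub> b)"
  shows "srem (a \<otimes>\<^bsub>SP\<^esub> srem (b \<otimes>\<^bsub>SP\<^esub> x))
    = srem (q \<otimes>\<^bsub>SP\<^esub> (binom \<otimes>\<^bsub>SP\<^esub> x)) \<oplus>\<^bsub>SP\<^esub> srem (srem (a \<otimes>\<^bsub>SP\<^esub> b) \<otimes>\<^bsub>SP\<^esub> x)"
proof -
  have c: "srem (a \<otimes>\<^bsub>SP\<^esub> b) \<in> up R" using assms(1,2) by (intro srem SP_mult_closed)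
  have "srem (a \<otimes>\<^bsub>SP\<^esub> srem (b \<otimes>\<^bsub>SP\<^esub> x)) = srem (a \<otimes>\<^bsub>SP\<^esub> (b \<otimes>\<^bsub>SP\<^esub> x))"
    using assms by (intro srem_mult_srem SP_mult_closed)
  also have "a \<otimes>\<^bsub>SP\<^esub> (b \<otimes>\<^bsub>SP\<^esub> x) = (a \<otimes>\<^bsub>SP\<^esub> b) \<otimes>\<^bsub>SP\<^esub> x"
    using assms by (simp add: SP_mult_assoc)
  also have "\<dots> = (q \<otimes>\<^bsub>SP\<^esub> binom \<oplus>\<^bsub>SP\<^esub> srem (a \<otimes>\<^bsub>SP\<^esub> b)) \<otimes>\<^bsub>SP\<^esub> x"
    by (rule arg_cong[OF assms(5)])
  also have "\<dots> = q \<otimes>\<^bsub>SP\<^esub> (binom \<otimes>\<^bsub>SP\<^esub> x) \<oplus>\<^bsub>SP\<^esub> srem (a \<otimes>\<^bsub>SP\<^esub> b) \<otimes>\<^bsub>SP\<^esub> x"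
    using assms(1-4) c by (simp add: P.l_distr SP_mult_assoc)
  also have "srem \<dots> = srem (q \<otimes>\<^bsub>SP\<^esub> (binom \<otimes>\<^bsub>SP\<^esub> x)) \<oplus>\<^bsub>SP\<^esub> srem (srem (a \<otimes>\<^bsub>SP\<^esub> b) \<otimes>\<^bsub>SP\<^esub> x)"
    using assms c by (intro srem_add SP_mult_closed) auto
  finally show ?thesis .
qed

text \<open>
  The right nucleus is the eigenring of \<open>t\<^sup>k - d\<close>. For \<open>k = 1\<close> the algebra is generated by constants
  and \<open>t\<close> is not one of its elements, hence the bound on \<open>k\<close>.
\<close>

lemma right_nucleus_iff:
  assumes "2 \<le> k"
  shows "x \<in> right_nucleus alg \<longleftrightarrow>
    x \<in> carrier alg \<and> (\<exists>q\<in>up R. binom \<otimes>\<^bsub>SP\<^esub> x = q \<otimes>\<^bsub>SP\<^esub> binom)"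
proof
  assume "x \<in> carrier alg \<and> (\<exists>q\<in>up R. binom \<otimes>\<^bsub>SP\<^esub> x = q \<otimes>\<^bsub>SP\<^esub> binom)"
  then obtain q where x: "x \<in> carrier alg" "x \<in> up R" and q: "q \<in> up R"
    and fx: "binom \<otimes>\<^bsub>SP\<^esub> x = q \<otimes>\<^bsub>SP\<^esub> binom" by (auto simp: alg_carrier)
  have "(a \<otimes>\<^bsub>alg\<^esub> b) \<otimes>\<^bsub>alg\<^esub> x = a \<otimes>\<^bsub>alg\<^esub> (b \<otimes>\<^bsub>alg\<^esub> x)"
    if "a \<in> carrier alg" "b \<in> carrier alg" for a b
  proof -
    have ab: "a \<in> up R" "b \<in> up R" using that by (auto simp: alg_carrier)
    obtain p where p: "p \<in> up R" "a \<otimes>\<^bsub>SP\<^esub> b = p \<otimes>\<^bsub>SP\<^esub> binom \<oplus>\<^bsub>SP\<^esub> srem (a \<otimes>\<^bsub>SP\<^esub> b)"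
      using srem(3)[OF SP_mult_closed[OF ab]] by (elim bexE) (rule that)
    have "srem (p \<otimes>\<^bsub>SP\<^esub> (binom \<otimes>\<^bsub>SP\<^esub> x)) = \<zero>\<^bsub>SP\<^esub>"
      unfolding fx using p(1) q srem_mult_binom[of "p \<otimes>\<^bsub>SP\<^esub> q"]
      by (simp add: SP_mult_assoc)
    then show ?thesis
      using srem_associator[OF ab x(2) p] srem(1)[of "srem (a \<otimes>\<^bsub>SP\<^esub> b) \<otimes>\<^bsub>SP\<^esub> x"] ab x(2)
      by (simp add: alg_mult srem)
  qed
  then show "x \<in> right_nucleus alg"
    using x by (simp add: right_nucleus_def)
next
  assume x: "x \<in> right_nucleus alg"
  then have xc: "x \<in> carrier alg" "x \<in> up R" by (auto simp: right_nucleus_def alg_carrier)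
  \<comment> \<open>The product of these two monomials has quotient \<open>1\<close>.\<close>
  define a b where "a = mon \<one> (k - 1)" and "b = mon \<one> 1"
  have ab: "a \<in> up R" "b \<in> up R" "low a" "low b"
    using assms by (auto simp: a_def b_def)
  have m: "mon d 0 \<in> up R" "low (mon d 0)" using k_pos by auto
  have prod: "a \<otimes>\<^bsub>SP\<^esub> b = mon \<one> k"
  proof
    fix i
    show "(a \<otimes>\<^bsub>SP\<^esub> b) i = mon \<one> k i"
      unfolding a_def using ab assms by (auto simp: mon_mult b_def)
  qed
  have eq: "mon \<one> k = \<one>\<^bsub>SP\<^esub> \<otimes>\<^bsub>SP\<^esub> binom \<oplus>\<^bsub>SP\<^esub> mon d 0"
    using P.add.inv_solve_right[of binom "mon \<one> k" "mon d 0"]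
    by (simp add: skew_binomial_def P.minus_eq)
  have r: "srem (a \<otimes>\<^bsub>SP\<^esub> b) = mon d 0"
    unfolding prod eq using m P.one_closed by (intro srem_eqI) auto
  have "srem (a \<otimes>\<^bsub>SP\<^esub> srem (b \<otimes>\<^bsub>SP\<^esub> x)) = srem (srem (a \<otimes>\<^bsub>SP\<^esub> b) \<otimes>\<^bsub>SP\<^esub> x)"
    using x ab unfolding right_nucleus_def by (auto simp: alg_carrier alg_mult)
  moreover have "srem (a \<otimes>\<^bsub>SP\<^esub> srem (b \<otimes>\<^bsub>SP\<^esub> x))
    = srem (\<one>\<^bsub>SP\<^esub> \<otimes>\<^bsub>SP\<^esub> (binom \<otimes>\<^bsub>SP\<^esub> x)) \<oplus>\<^bsub>SP\<^esub> srem (srem (a \<otimes>\<^bsub>SP\<^esub> b) \<otimes>\<^bsub>SP\<^esub> x)"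
    using srem_associator[OF ab(1,2) xc(2), of "\<one>\<^bsub>SP\<^esub>"] P.one_closed prod eq r by simp
  moreover have "srem (srem (a \<otimes>\<^bsub>SP\<^esub> b) \<otimes>\<^bsub>SP\<^esub> x) \<in> up R" "srem (binom \<otimes>\<^bsub>SP\<^esub> x) \<in> up R"
    using ab xc by (auto intro!: srem(1) SP_mult_closed)
  ultimately have "srem (binom \<otimes>\<^bsub>SP\<^esub> x) = \<zero>\<^bsub>SP\<^esub>"
    using xc by simp
  then show "x \<in> carrier alg \<and> (\<exists>q\<in>up R. binom \<otimes>\<^bsub>SP\<^esub> x = q \<otimes>\<^bsub>SP\<^esub> binom)"
    using xc srem_eq_zero_iff[of "binom \<otimes>\<^bsub>SP\<^esub> x"] by auto
qed

lemma binom_commute_iff: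
  assumes "x \<in> up R" and "\<And>a. a \<in> carrier R \<Longrightarrow> (\<rho> ^^ k) a = a"
  shows "binom \<otimes>\<^bsub>SP\<^esub> x = x \<otimes>\<^bsub>SP\<^esub> binom \<longleftrightarrow> (\<forall>i. d \<otimes> x i = x i \<otimes> (\<rho> ^^ i) d)"
proof -
  have inj: "u \<in> carrier R \<Longrightarrow> v \<in> carrier R \<Longrightarrow> \<ominus> u = \<ominus> v \<longleftrightarrow> u = v" for u v
    by (metis minus_minus)
  have *: "(binom \<otimes>\<^bsub>SP\<^esub> x) i = (x \<otimes>\<^bsub>SP\<^esub> binom) i \<longleftrightarrow> d \<otimes> x i = x i \<otimes> (\<rho> ^^ i) d" for i
    using assms by (simp add: binom_mult mult_binom minus_eq inj)
  show ?thesis unfolding fun_eq_iff * ..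
qed

lemma right_nucleus_support:
  assumes "2 \<le> k" and id: "\<And>a. a \<in> carrier R \<Longrightarrow> (\<rho> ^^ k) a = a"
    and central: "\<And>a. a \<in> carrier R \<Longrightarrow> d \<otimes> a = a \<otimes> d"
    and integral: "\<And>a b. a \<in> carrier R \<Longrightarrow> b \<in> carrier R \<Longrightarrow> a \<otimes> b = \<zero> \<Longrightarrow> a = \<zero> \<or> b = \<zero>"
  shows "x \<in> right_nucleus alg \<longleftrightarrow> x \<in> carrier alg \<and> (\<forall>i. x i = \<zero> \<or> (\<rho> ^^ i) d = d)"
proof (cases "x \<in> carrier alg")
  case True
  then have x: "x \<in> up R" by (simp add: alg_carrier)
  have comm: "d \<otimes> x i = x i \<otimes> (\<rho> ^^ i) d \<longleftrightarrow> x i = \<zero> \<or> (\<rho> ^^ i) d = d" for i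
  proof
    assume "d \<otimes> x i = x i \<otimes> (\<rho> ^^ i) d"
    then have "x i \<otimes> ((\<rho> ^^ i) d \<ominus> d) = \<zero>"
      using x central[of "x i"] by (simp add: minus_eq r_distr r_minus r_neg)
    then have "x i = \<zero> \<or> (\<rho> ^^ i) d \<ominus> d = \<zero>"
      using x by (intro integral) auto
    then show "x i = \<zero> \<or> (\<rho> ^^ i) d = d" by simp
  next
    assume "x i = \<zero> \<or> (\<rho> ^^ i) d = d"
    then show "d \<otimes> x i = x i \<otimes> (\<rho> ^^ i) d" using x central[of "x i"] by auto
  qed
  \<comment> \<open>\<open>(q - x) (t\<^sup>k - d)\<close> equals \<open>(t\<^sup>k - d) x - x (t\<^sup>k - d)\<close>, whose coefficients from \<open>k\<close> on vanish.\<close>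
  have "binom \<otimes>\<^bsub>SP\<^esub> x = x \<otimes>\<^bsub>SP\<^esub> binom"
    if q: "q \<in> up R" "binom \<otimes>\<^bsub>SP\<^esub> x = q \<otimes>\<^bsub>SP\<^esub> binom" for q
  proof -
    have c: "q \<ominus>\<^bsub>SP\<^esub> x \<in> up R" using q x P.minus_closed[of q x] by simp
    have e: "(q \<ominus>\<^bsub>SP\<^esub> x) \<otimes>\<^bsub>SP\<^esub> binom = binom \<otimes>\<^bsub>SP\<^esub> x \<ominus>\<^bsub>SP\<^esub> x \<otimes>\<^bsub>SP\<^esub> binom"
      using q x by (simp add: P.minus_eq P.l_distr P.l_minus)
    have "low ((q \<ominus>\<^bsub>SP\<^esub> x) \<otimes>\<^bsub>SP\<^esub> binom)"
    proof (intro allI impI)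
      fix i assume "k \<le> i"
      then have "x i = \<zero>" using True by (simp add: alg_carrier)
      then show "((q \<ominus>\<^bsub>SP\<^esub> x) \<otimes>\<^bsub>SP\<^esub> binom) i = \<zero>"
        unfolding e using x id \<open>k \<le> i\<close>
        by simp (simp add: binom_mult mult_binom minus_eq r_neg)
    qed
    then have "q \<ominus>\<^bsub>SP\<^esub> x = \<zero>\<^bsub>SP\<^esub>" using low_mult_binom_zero[OF c] by simp
    then have "q = x" using q x by (simp add: P.r_right_minus_eq)
    then show ?thesis using q by simp
  qed
  then have "(\<exists>q\<in>up R. binom \<otimes>\<^bsub>SP\<^esub> x = q \<otimes>\<^bsub>SP\<^esub> binom) \<longleftrightarrow> binom \<otimes>\<^bsub>SP\<^esub> x = x \<otimes>\<^bsub>SP\<^esub> binom"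
    using x by blast
  then show ?thesis
    using right_nucleus_iff[OF assms(1), of x] True binom_commute_iff[OF x id] comm by simp
next
  case False
  then show ?thesis by (simp add: right_nucleus_def)
qed

end

section \<open>The substitution \<open>t \<mapsto> t\<^sup>s\<close> and the nucleus as a quotient\<close>

text \<open>
  Here \<open>\<rho>\<^sup>k\<close> is the identity, \<open>d\<close> is central in a ring without zero divisors, and the powers of \<open>\<rho>\<close>
  that fix \<open>d\<close> are the powers of \<open>\<rho>\<^sup>s\<close>. The prefix \<open>Q\<close> refers to the skew polynomials over \<open>\<rho>\<^sup>s\<close> and their
  division by \<open>t\<^sup>r - d\<close>.
\<close>

locale skew_binom_power = skew_binom R \<rho> k d for R (structure) and \<rho> k d +
  fixes s r :: nat
  assumes k_eq: "k = s * r" and k_ge: "2 \<le> k"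
    and rho_k: "\<And>a. a \<in> carrier R \<Longrightarrow> (\<rho> ^^ k) a = a"
    and rho_d: "\<And>i. (\<rho> ^^ i) d = d \<longleftrightarrow> s dvd i"
    and d_central: "\<And>a. a \<in> carrier R \<Longrightarrow> d \<otimes> a = a \<otimes> d"
    and integral: "\<And>a b. a \<in> carrier R \<Longrightarrow> b \<in> carrier R \<Longrightarrow> a \<otimes> b = \<zero> \<Longrightarrow> a = \<zero> \<or> b = \<zero>"
begin

lemma s_pos: "0 < s" and r_pos: "0 < r"
  using k_eq k_pos by auto

sublocale Q: skew_binom R "\<rho> ^^ s" r d
  using rho_pow_hom r_pos one_not_zero by unfold_locales auto

abbreviation sub :: "(nat \<Rightarrow> 'a) \<Rightarrow> nat \<Rightarrow> 'a" where
  "sub \<equiv> subst_power R s"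

lemma right_nucleus_alg:
  "right_nucleus alg = {g \<in> carrier alg. \<forall>i. \<not> s dvd i \<longrightarrow> g i = \<zero>}"
  using right_nucleus_support[OF k_ge rho_k d_central integral] rho_d by blast

lemma sub_closed [simp]: "p \<in> up R \<Longrightarrow> sub p \<in> up R"
proof -
  assume p: "p \<in> up R"
  obtain N where N: "\<And>i. N \<le> i \<Longrightarrow> p i = \<zero>" using up_boundE[OF p] by blast
  have "sub p i = \<zero>" if "s * N \<le> i" for i
  proof -
    have "N \<le> i div s" using that s_pos by (simp add: less_eq_div_iff_mult_less_eq mult.commute)
    then show ?thesis using N by (simp add: subst_power_def)
  qed
  then show ?thesis
    using p by (intro upI[where N = "s * N"]) (simp_all add: subst_power_def)
qed

lemma sub_inj: "sub p = sub q \<Longrightarrow> p = q"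
proof
  fix i
  assume "sub p = sub q"
  then have "sub p (s * i) = sub q (s * i)" by simp
  then show "p i = q i" using s_pos by (simp add: subst_power_def)
qed

lemma sub_low_iff: "low (sub p) \<longleftrightarrow> Q.low p"
proof
  assume l: "low (sub p)"
  show "Q.low p"
  proof (intro allI impI)
    fix i assume "r \<le> i"
    then have "sub p (s * i) = \<zero>" using l by (simp add: k_eq)
    then show "p i = \<zero>" using s_pos by (simp add: subst_power_def)
  qed
next
  assume l: "Q.low p"
  show "low (sub p)"
  proof (intro allI impI)
    fix i assume "k \<le> i"
    then have "r \<le> i div s" using s_pos by (simp add: k_eq less_eq_div_iff_mult_less_eq mult.commute)
    then show "sub p i = \<zero>" using l by (simp add: subst_power_def)
  qed
qed

lemma sub_zero: "sub \<zero>\<^bsub>SP\<^esub> = \<zero>\<^bsub>SP\<^esub>"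
  by (auto simp: SP_zero subst_power_def)

lemma sub_one: "sub \<one>\<^bsub>Q.SP\<^esub> = \<one>\<^bsub>SP\<^esub>"
  using s_pos by (auto simp: SP_one Q.SP_one subst_power_def fun_eq_iff)

lemma sub_add: "p \<in> up R \<Longrightarrow> q \<in> up R \<Longrightarrow> sub (p \<oplus>\<^bsub>Q.SP\<^esub> q) = sub p \<oplus>\<^bsub>SP\<^esub> sub q"
  by (auto simp: fun_eq_iff) (auto simp: subst_power_def)

text \<open>The identity \<open>t\<^sup>s a = \<rho>\<^sup>s(a) t\<^sup>s\<close> makes the substitution multiplicative.\<close>

lemma sub_mult:
  assumes "p \<in> up R" "q \<in> up R"
  shows "sub (p \<otimes>\<^bsub>Q.SP\<^esub> q) = sub p \<otimes>\<^bsub>SP\<^esub> sub q"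
proof
  fix n
  define f where "f i = sub p i \<otimes> (\<rho> ^^ i) (sub q (n - i))" for i
  have f: "f i \<in> carrier R" for i using assms by (simp add: f_def)
  have rhs: "(sub p \<otimes>\<^bsub>SP\<^esub> sub q) n = (\<Oplus>i\<in>{..n}. f i)"
    using assms by (simp add: SP_mult f_def)
  have f0: "f i = \<zero>" if "\<not> s dvd i" for i
    using that assms by (simp add: f_def subst_power_def)
  show "sub (p \<otimes>\<^bsub>Q.SP\<^esub> q) n = (sub p \<otimes>\<^bsub>SP\<^esub> sub q) n"
  proof (cases "s dvd n")
    case False
    have "f i = \<zero>" if "i \<le> n" for i
    proof (cases "s dvd i")
      case True
      with False that have "\<not> s dvd n - i" by (metis dvd_diffD)
      then show ?thesis using assms by (simp add: f_def subst_power_def)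
    qed (rule f0)
    then have "(\<Oplus>i\<in>{..n}. f i) = (\<Oplus>i\<in>{..n}. \<zero>)"
      by (intro finsum_cong') auto
    then show ?thesis unfolding rhs using False by (simp add: subst_power_def)
  next
    case True
    then obtain n' where n: "n = s * n'" by blast
    have inj: "inj_on ((*) s) {..n'}" using s_pos by (auto intro: inj_onI)
    have "(\<Oplus>i\<in>{..n}. f i) = (\<Oplus>i\<in>(*) s ` {..n'}. f i)"
    proof (rule add.finprod_mono_neutral_cong_right)
      show "(*) s ` {..n'} \<subseteq> {..n}" using n by auto
    next
      fix i assume i: "i \<in> {..n} - (*) s ` {..n'}"
      have "\<not> s dvd i"
      proof
        assume "s dvd i"
        then obtain j where "i = s * j" by blast
        with i n s_pos show False by auto
      qed
      then show "f i = \<zero>" by (rule f0)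
    qed (use f in auto)
    also have "\<dots> = (\<Oplus>j\<in>{..n'}. f (s * j))"
      by (rule finsum_reindex[OF _ inj]) (use f in auto)
    also have "\<dots> = (\<Oplus>j\<in>{..n'}. p j \<otimes> ((\<rho> ^^ s) ^^ j) (q (n' - j)))"
    proof (rule finsum_cong'[OF refl])
      fix j assume "j \<in> {..n'}"
      have "n - s * j = s * (n' - j)" by (simp add: n right_diff_distrib')
      then show "f (s * j) = p j \<otimes> ((\<rho> ^^ s) ^^ j) (q (n' - j))"
        using s_pos by (simp add: f_def subst_power_def funpow_mult mult.commute)
    qed (use assms in auto)
    finally show ?thesis
      unfolding rhs using n s_pos assms by (simp add: subst_power_def Q.SP_mult)
  qed
qed

lemma sub_binom: "sub Q.binom = binom"
proof
  fix i
  show "sub Q.binom i = binom i"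
    unfolding skew_binomial_def using s_pos by (auto simp: subst_power_def k_eq minus_eq)
qed

lemma srem_sub:
  assumes "p \<in> up R"
  shows "srem (sub p) = sub (Q.srem p)"
proof -
  obtain q where q: "q \<in> up R" "p = q \<otimes>\<^bsub>Q.SP\<^esub> Q.binom \<oplus>\<^bsub>Q.SP\<^esub> Q.srem p"
    using Q.srem(3)[OF assms] by (elim bexE) (rule that)
  note c = Q.srem(1)[OF assms] Q.srem(2)[OF assms]
  have "srem (sub p) = srem (sub (q \<otimes>\<^bsub>Q.SP\<^esub> Q.binom \<oplus>\<^bsub>Q.SP\<^esub> Q.srem p))"
    by (rule arg_cong[OF q(2), where f = "\<lambda>z. srem (sub z)"])
  also have "\<dots> = srem (sub q \<otimes>\<^bsub>SP\<^esub> binom \<oplus>\<^bsub>SP\<^esub> sub (Q.srem p))"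
    using q(1) c(1) by (simp add: sub_add sub_mult sub_binom)
  also have "\<dots> = sub (Q.srem p)"
    using q(1) c sub_low_iff by (intro srem_eqI) auto
  finally show ?thesis .
qed

lemma sub_Q_srem_nucleus:
  assumes "p \<in> up R"
  shows "sub (Q.srem p) \<in> right_nucleus alg"
proof -
  have "Q.srem p \<in> up R" "low (sub (Q.srem p))"
    using Q.srem[OF assms] sub_low_iff by auto
  moreover have "sub (Q.srem p) i = \<zero>" if "\<not> s dvd i" for i
    using that by (simp add: subst_power_def)
  ultimately show ?thesis
    unfolding right_nucleus_alg alg_carrier by simp
qed

text \<open>
  \<open>t\<^sup>k - d\<close> commutes with every polynomial in \<open>t\<^sup>s\<close>, so that reduction modulo \<open>t\<^sup>k - d\<close> respects
  products of such polynomials.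
\<close>

lemma srem_sub_mult:
  assumes "p \<in> up R" "q \<in> up R"
  shows "srem (sub (p \<otimes>\<^bsub>Q.SP\<^esub> q)) = srem (srem (sub p) \<otimes>\<^bsub>SP\<^esub> srem (sub q))"
proof -
  let ?p = "sub p" and ?q = "sub q"
  have c: "?p \<in> up R" "?q \<in> up R" "srem ?p \<in> up R" using assms by (auto intro: srem)
  have comm: "binom \<otimes>\<^bsub>SP\<^esub> ?q = ?q \<otimes>\<^bsub>SP\<^esub> binom"
  proof -
    have "d \<otimes> ?q i = ?q i \<otimes> (\<rho> ^^ i) d" for i
    proof (cases "s dvd i")
      case True
      then show ?thesis using rho_d[of i] d_central[OF up_closed[OF c(2)]] by simp
    next
      case False
      then have "?q i = \<zero>" by (simp add: subst_power_def)
      then show ?thesis by simp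
    qed
    then show ?thesis using binom_commute_iff[OF c(2) rho_k] by blast
  qed
  obtain u where u: "u \<in> up R" "?p = u \<otimes>\<^bsub>SP\<^esub> binom \<oplus>\<^bsub>SP\<^esub> srem ?p"
    using srem(3)[OF c(1)] by (elim bexE) (rule that)
  have "srem (sub (p \<otimes>\<^bsub>Q.SP\<^esub> q)) = srem (?p \<otimes>\<^bsub>SP\<^esub> ?q)"
    using assms by (simp add: sub_mult)
  also have "\<dots> = srem ((u \<otimes>\<^bsub>SP\<^esub> binom \<oplus>\<^bsub>SP\<^esub> srem ?p) \<otimes>\<^bsub>SP\<^esub> ?q)"
    by (rule arg_cong[OF u(2), where f = "\<lambda>z. srem (z \<otimes>\<^bsub>SP\<^esub> ?q)"])
  also have "(u \<otimes>\<^bsub>SP\<^esub> binom \<oplus>\<^bsub>SP\<^esub> srem ?p) \<otimes>\<^bsub>SP\<^esub> ?q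
      = u \<otimes>\<^bsub>SP\<^esub> ?q \<otimes>\<^bsub>SP\<^esub> binom \<oplus>\<^bsub>SP\<^esub> srem ?p \<otimes>\<^bsub>SP\<^esub> ?q"
    using u(1) c by (simp add: P.l_distr SP_mult_assoc comm)
  also have "srem (u \<otimes>\<^bsub>SP\<^esub> ?q \<otimes>\<^bsub>SP\<^esub> binom \<oplus>\<^bsub>SP\<^esub> srem ?p \<otimes>\<^bsub>SP\<^esub> ?q)
      = srem (u \<otimes>\<^bsub>SP\<^esub> ?q \<otimes>\<^bsub>SP\<^esub> binom) \<oplus>\<^bsub>SP\<^esub> srem (srem ?p \<otimes>\<^bsub>SP\<^esub> ?q)"
    using u(1) c by (intro srem_add) auto
  also have "\<dots> = srem (srem ?p \<otimes>\<^bsub>SP\<^esub> ?q)"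
    using u(1) c srem(1)[of "srem ?p \<otimes>\<^bsub>SP\<^esub> ?q"] by (simp add: srem_mult_binom)
  also have "\<dots> = srem (srem ?p \<otimes>\<^bsub>SP\<^esub> srem ?q)"
    using c by (simp add: srem_mult_srem)
  finally show ?thesis .
qed

text \<open>The right nucleus with the inherited operations.\<close>

abbreviation nuc :: "('a, nat \<Rightarrow> 'a) up_ring" where
  "nuc \<equiv> alg\<lparr>carrier := right_nucleus alg\<rparr>"

text \<open>Substitution followed by reduction modulo \<open>t\<^sup>k - d\<close>.\<close>

abbreviation red :: "(nat \<Rightarrow> 'a) \<Rightarrow> nat \<Rightarrow> 'a" where
  "red p \<equiv> srem (sub p)"

lemma red_hom: "red \<in> ring_hom Q.SP nuc"
proof (rule ring_hom_memI)
  fix p q assume "p \<in> carrier Q.SP" "q \<in> carrier Q.SP"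
  then have pq: "p \<in> up R" "q \<in> up R" by auto
  show "red p \<in> carrier nuc" using pq sub_Q_srem_nucleus srem_sub by simp
  show "red (p \<otimes>\<^bsub>Q.SP\<^esub> q) = red p \<otimes>\<^bsub>nuc\<^esub> red q"
    using srem_sub_mult[OF pq] by (simp add: alg_mult)
  show "red (p \<oplus>\<^bsub>Q.SP\<^esub> q) = red p \<oplus>\<^bsub>nuc\<^esub> red q"
    using pq by (simp add: sub_add srem_add)
next
  have "low \<one>\<^bsub>SP\<^esub>" using k_pos by simp
  then show "red \<one>\<^bsub>Q.SP\<^esub> = \<one>\<^bsub>nuc\<^esub>"
    by (simp add: sub_one srem_low)
qed

lemma red_image: "red ` carrier Q.SP = right_nucleus alg"
proof
  show "red ` carrier Q.SP \<subseteq> right_nucleus alg"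
    using sub_Q_srem_nucleus srem_sub by auto
  show "right_nucleus alg \<subseteq> red ` carrier Q.SP"
  proof
    fix x assume x: "x \<in> right_nucleus alg"
    then have xu: "x \<in> up R" "low x" "\<And>i. \<not> s dvd i \<Longrightarrow> x i = \<zero>"
      by (auto simp: right_nucleus_alg alg_carrier)
    define p where "p i = x (s * i)" for i
    have px: "sub p = x"
      using xu(3) by (auto simp: subst_power_def p_def fun_eq_iff)
    have "Q.low p" using px xu(2) sub_low_iff[of p] by simp
    then have "p \<in> up R" using xu(1) by (intro upI) (auto simp: p_def)
    moreover have "red p = x" using px xu srem_low by simp
    ultimately show "x \<in> red ` carrier Q.SP" by auto
  qed
qed

lemma nuc_ring: "ring nuc"
proof -
  have z: "red \<zero>\<^bsub>Q.SP\<^esub> = \<zero>\<^bsub>alg\<^esub>"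
    using srem_low[of "\<zero>\<^bsub>SP\<^esub>"] sub_zero by (simp add: SP_zero Q.SP_zero upI)
  have "nuc\<lparr>carrier := red ` carrier Q.SP, zero := red \<zero>\<^bsub>Q.SP\<^esub>\<rparr> = nuc"
    unfolding z red_image by simp
  then show ?thesis
    using Q.P.ring_hom_imp_img_ring[OF red_hom] by simp
qed

text \<open>
  If the reduction of \<open>p\<close> is zero, then so is the remainder of \<open>p\<close> modulo \<open>t\<^sup>r - d\<close>, and \<open>p\<close> is even a
  left multiple of \<open>t\<^sup>r - d\<close>.
\<close>

lemma red_kernel: "a_kernel Q.SP nuc red = genideal Q.SP {Q.binom}"
proof -
  interpret h: ring_hom_ring Q.SP nuc red
    by (rule ring_hom_ringI2[OF Q.SP_ring nuc_ring red_hom])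
  have I: "ideal (genideal Q.SP {Q.binom}) Q.SP"
    by (rule Q.P.genideal_ideal) simp
  show ?thesis
  proof
    have "red Q.binom = \<zero>\<^bsub>nuc\<^esub>"
      using srem_mult_binom[of "\<one>\<^bsub>SP\<^esub>"] by (simp add: sub_binom)
    then have "Q.binom \<in> a_kernel Q.SP nuc red"
      unfolding a_kernel_def' by simp
    then show "genideal Q.SP {Q.binom} \<subseteq> a_kernel Q.SP nuc red"
      by (intro Q.P.genideal_minimal[OF h.kernel_is_ideal]) blast
    show "a_kernel Q.SP nuc red \<subseteq> genideal Q.SP {Q.binom}"
    proof
      fix p assume "p \<in> a_kernel Q.SP nuc red"
      then have p: "p \<in> up R" "red p = \<zero>\<^bsub>SP\<^esub>"
        unfolding a_kernel_def' by simp_all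
      then have "sub (Q.srem p) = sub \<zero>\<^bsub>SP\<^esub>" using srem_sub sub_zero by simp
      then have "Q.srem p = \<zero>\<^bsub>Q.SP\<^esub>" using sub_inj by (simp add: SP_zero Q.SP_zero)
      then obtain q where "q \<in> up R" "p = q \<otimes>\<^bsub>Q.SP\<^esub> Q.binom"
        using Q.srem_eq_zero_iff[OF p(1)] by blast
      then show "p \<in> genideal Q.SP {Q.binom}"
        using ideal.I_l_closed[OF I Q.P.genideal_self'[of Q.binom], of q] by simp
    qed
  qed
qed

theorem nucleus_iso_quotient:
  "\<exists>\<Phi>\<in>ring_iso (Q.SP Quot genideal Q.SP {Q.binom}) nuc.
     \<forall>p\<in>carrier Q.SP. deg R p < r \<longrightarrow> \<Phi> (genideal Q.SP {Q.binom} +>\<^bsub>Q.SP\<^esub> p) = sub p"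
proof -
  interpret h: ring_hom_ring Q.SP nuc red
    by (rule ring_hom_ringI2[OF Q.SP_ring nuc_ring red_hom])
  let ?h = "\<lambda>Z. the_elem (red ` Z)"
  have iso: "?h \<in> ring_iso (Q.SP Quot genideal Q.SP {Q.binom}) nuc"
    using h.FactRing_iso_set red_image unfolding red_kernel by simp
  have "?h (genideal Q.SP {Q.binom} +>\<^bsub>Q.SP\<^esub> p) = sub p"
    if p: "p \<in> carrier Q.SP" "deg R p < r" for p
  proof -
    have "p \<in> up R" "low (sub p)" using p deg_less_iff r_pos sub_low_iff by auto
    then have "red p = sub p" by (intro srem_low) auto
    then show ?thesis using h.the_elem_simp[OF p(1)] unfolding red_kernel by simp
  qed
  then show ?thesis by (intro bexI[OF _ iso] ballI impI)
qed

end

section \<open>Linear systems over a field\<close>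

lemma (in abelian_monoid) finsum_swap:
  assumes "finite A" "finite B" "\<And>a b. a \<in> A \<Longrightarrow> b \<in> B \<Longrightarrow> f a b \<in> carrier G"
  shows "(\<Oplus>a\<in>A. \<Oplus>b\<in>B. f a b) = (\<Oplus>b\<in>B. \<Oplus>a\<in>A. f a b)"
  using assms(1,3)
proof (induct A)
  case empty
  show ?case by simp
next
  case (insert x A)
  have "(\<Oplus>b\<in>B. \<Oplus>a\<in>insert x A. f a b) = (\<Oplus>b\<in>B. f x b \<oplus> (\<Oplus>a\<in>A. f a b))"
    by (rule finsum_cong'[OF refl])
      (use insert in \<open>auto intro!: finsum_insert add.m_closed finsum_closed\<close>)
  also have "\<dots> = (\<Oplus>b\<in>B. f x b) \<oplus> (\<Oplus>b\<in>B. \<Oplus>a\<in>A. f a b)"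
    by (rule finsum_addf) (use insert in \<open>auto intro!: finsum_closed\<close>)
  also have "(\<Oplus>b\<in>B. \<Oplus>a\<in>A. f a b) = (\<Oplus>a\<in>A. \<Oplus>b\<in>B. f a b)"
    using insert by simp
  also have "(\<Oplus>b\<in>B. f x b) \<oplus> (\<Oplus>a\<in>A. \<Oplus>b\<in>B. f a b) = (\<Oplus>a\<in>insert x A. \<Oplus>b\<in>B. f a b)"
    by (rule finsum_insert[symmetric]) (use insert in \<open>auto intro!: finsum_closed\<close>)
  finally show ?case by simp
qed

text \<open>
  A homogeneous linear system with more unknowns, indexed by \<open>J\<close>, than equations, indexed by \<open>I\<close>.
\<close>

lemma (in field) homogeneous_system_solvable:
  assumes "finite I" "finite J" "card I < card J"
    and "\<And>i j. i \<in> I \<Longrightarrow> j \<in> J \<Longrightarrow> a i j \<in> carrier R"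
  shows "\<exists>c. (\<forall>j\<in>J. c j \<in> carrier R) \<and> (\<exists>j\<in>J. c j \<noteq> \<zero>) \<and>
    (\<forall>i\<in>I. (\<Oplus>j\<in>J. c j \<otimes> a i j) = \<zero>)"
  using assms
proof (induct I arbitrary: J a)
  case empty
  then obtain j where "j \<in> J" by fastforce
  then show ?case by (intro exI[of _ "\<lambda>_. \<one>"]) auto
next
  case (insert l I)
  show ?case
  proof (cases "\<forall>j\<in>J. a l j = \<zero>")
    case True
    have "card I < card J" using insert by simp
    then obtain c where c: "\<forall>j\<in>J. c j \<in> carrier R" "\<exists>j\<in>J. c j \<noteq> \<zero>"
        "\<forall>i\<in>I. (\<Oplus>j\<in>J. c j \<otimes> a i j) = \<zero>"
      using insert(3)[OF insert(4), of a] insert(6) by blast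
    have "(\<Oplus>j\<in>J. c j \<otimes> a l j) = (\<Oplus>j\<in>J. \<zero>)"
      by (rule finsum_cong') (use True c in auto)
    then show ?thesis using c by (intro exI[of _ c]) auto
  next
    case False
    then obtain j0 where j0: "j0 \<in> J" "a l j0 \<noteq> \<zero>" by blast
    define K where "K = J - {j0}"
    have K: "finite K" "j0 \<notin> K" "J = insert j0 K" "card I < card K"
      using insert(1,2,4,5) j0 by (auto simp: K_def)
    have ac: "\<And>i j. i \<in> insert l I \<Longrightarrow> j \<in> K \<Longrightarrow> a i j \<in> carrier R"
      "\<And>i. i \<in> insert l I \<Longrightarrow> a i j0 \<in> carrier R"
      using insert(6) K(3) by auto
    define b where "b = inv (a l j0)"
    have b: "b \<in> carrier R" "b \<otimes> a l j0 = \<one>"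
      using j0 ac(2)[of l] field_Units by (auto simp: b_def)
    \<comment> \<open>Subtract multiples of the equation \<open>l\<close> to eliminate the unknown \<open>j0\<close> from the others.\<close>
    define e where "e i = \<ominus> (a i j0 \<otimes> b)" for i
    have e: "e i \<in> carrier R" if "i \<in> insert l I" for i
      unfolding e_def using that ac b by auto
    have "\<exists>c. (\<forall>j\<in>K. c j \<in> carrier R) \<and> (\<exists>j\<in>K. c j \<noteq> \<zero>) \<and>
        (\<forall>i\<in>I. (\<Oplus>j\<in>K. c j \<otimes> (a i j \<oplus> e i \<otimes> a l j)) = \<zero>)"
      by (rule insert(3)[OF K(1,4)]) (use ac e in auto)
    then obtain c where c: "\<And>j. j \<in> K \<Longrightarrow> c j \<in> carrier R" "\<exists>j\<in>K. c j \<noteq> \<zero>"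
        "\<And>i. i \<in> I \<Longrightarrow> (\<Oplus>j\<in>K. c j \<otimes> (a i j \<oplus> e i \<otimes> a l j)) = \<zero>"
      by blast
    define S where "S i = (\<Oplus>j\<in>K. c j \<otimes> a i j)" for i
    have S: "S i \<in> carrier R" if "i \<in> insert l I" for i
      unfolding S_def by (rule finsum_closed) (use c ac that in auto)
    have elim: "(\<Oplus>j\<in>K. c j \<otimes> (a i j \<oplus> e i \<otimes> a l j)) = S i \<oplus> e i \<otimes> S l" if i: "i \<in> insert l I" for i
    proof -
      have "(\<Oplus>j\<in>K. c j \<otimes> (a i j \<oplus> e i \<otimes> a l j)) = (\<Oplus>j\<in>K. c j \<otimes> a i j \<oplus> e i \<otimes> (c j \<otimes> a l j))"
        by (rule finsum_cong') (use c(1) ac e i in \<open>auto simp: r_distr m_lcomm\<close>)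
      also have "\<dots> = S i \<oplus> (\<Oplus>j\<in>K. e i \<otimes> (c j \<otimes> a l j))"
        unfolding S_def by (rule finsum_addf) (use c(1) ac e i in auto)
      also have "(\<Oplus>j\<in>K. e i \<otimes> (c j \<otimes> a l j)) = e i \<otimes> S l"
        unfolding S_def by (rule finsum_rdistr[symmetric]) (use c(1) ac e i K in auto)
      finally show ?thesis .
    qed
    define c' where "c' = c(j0 := \<ominus> (S l \<otimes> b))"
    have c': "c' j0 = \<ominus> (S l \<otimes> b)" "\<And>j. j \<in> K \<Longrightarrow> c' j = c j"
      using K(2) by (auto simp: c'_def)
    have c'c: "\<forall>j\<in>J. c' j \<in> carrier R"
      unfolding K(3) using c' c(1) S[of l] b by auto
    have eq: "(\<Oplus>j\<in>J. c' j \<otimes> a i j) = S i \<oplus> e i \<otimes> S l" if i: "i \<in> insert l I" for i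
    proof -
      have "(\<Oplus>j\<in>J. c' j \<otimes> a i j) = c' j0 \<otimes> a i j0 \<oplus> (\<Oplus>j\<in>K. c' j \<otimes> a i j)"
        unfolding K(3) by (rule finsum_insert) (use K c'c ac i in auto)
      also have "(\<Oplus>j\<in>K. c' j \<otimes> a i j) = S i"
        unfolding S_def by (rule finsum_cong') (use c'(2) c(1) ac i in auto)
      also have "c' j0 \<otimes> a i j0 = e i \<otimes> S l"
        unfolding c' e_def using S[of l] b(1) ac(2)[OF i] by (simp add: l_minus r_minus m_ac)
      finally show ?thesis using S[OF i] S[of l] e[OF i] by (simp add: a_comm)
    qed
    have "(\<Oplus>j\<in>J. c' j \<otimes> a i j) = \<zero>" if i: "i \<in> insert l I" for i
    proof (cases "i = l")
      case True
      have "e l = \<ominus> \<one>" unfolding e_def using b ac(2)[of l] by (simp add: m_comm)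
      then show ?thesis
        using eq[OF i] S[of l] True by (simp add: l_minus r_neg)
    next
      case False
      then show ?thesis using eq[OF i] elim[OF i] c(3)[of i] i by simp
    qed
    moreover have "\<exists>j\<in>J. c' j \<noteq> \<zero>" using c(2) c'(2) K(3) by auto
    ultimately show ?thesis using c'c by blast
  qed
qed

section \<open>Automorphisms of a field\<close>

lemma (in ring) endo_finsum:
  assumes "\<tau> \<in> ring_hom R R" "finite A" "\<And>x. x \<in> A \<Longrightarrow> f x \<in> carrier R"
  shows "\<tau> (\<Oplus>x\<in>A. f x) = (\<Oplus>x\<in>A. \<tau> (f x))"
  using ring_hom_ring.hom_finsum[OF ring_hom_ringI2[OF ring_axioms ring_axioms assms(1)], of f A] assms(3)
  by (auto simp: comp_def)

text \<open>
  Dedekind: distinct endomorphisms of a field are linearly independent. Being extensional, distinct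
  ones differ at an element of the carrier.
\<close>

lemma (in field) endomorphisms_independent:
  assumes "finite S" "S \<subseteq> ring_hom R R" "S \<subseteq> extensional (carrier R)"
    and "\<And>\<tau>. \<tau> \<in> S \<Longrightarrow> c \<tau> \<in> carrier R"
    and "\<And>x. x \<in> carrier R \<Longrightarrow> (\<Oplus>\<tau>\<in>S. c \<tau> \<otimes> \<tau> x) = \<zero>"
  shows "\<forall>\<tau>\<in>S. c \<tau> = \<zero>"
  using assms
proof (induct S arbitrary: c)
  case empty
  show ?case by simp
next
  case (insert \<tau> S)
  have hom: "\<And>\<rho>. \<rho> \<in> insert \<tau> S \<Longrightarrow> \<rho> \<in> ring_hom R R" using insert by auto
  have cl: "\<And>\<rho> x. \<rho> \<in> insert \<tau> S \<Longrightarrow> x \<in> carrier R \<Longrightarrow> \<rho> x \<in> carrier R"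
    and mul: "\<And>\<rho> x y. \<rho> \<in> insert \<tau> S \<Longrightarrow> x \<in> carrier R \<Longrightarrow> y \<in> carrier R \<Longrightarrow> \<rho> (x \<otimes> y) = \<rho> x \<otimes> \<rho> y"
    and one: "\<And>\<rho>. \<rho> \<in> insert \<tau> S \<Longrightarrow> \<rho> \<one> = \<one>"
    using ring_hom_memE[OF hom] by auto
  have cc: "\<And>\<rho>. \<rho> \<in> insert \<tau> S \<Longrightarrow> c \<rho> \<in> carrier R" using insert(6) by simp
  define s where "s x = (\<Oplus>\<rho>\<in>S. c \<rho> \<otimes> \<rho> x)" for x
  have s: "s x \<in> carrier R" if "x \<in> carrier R" for x
    unfolding s_def by (rule finsum_closed) (use cc cl that in auto)
  have rel: "c \<tau> \<otimes> \<tau> x \<oplus> s x = \<zero>" if "x \<in> carrier R" for x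
  proof -
    have "(\<Oplus>\<rho>\<in>insert \<tau> S. c \<rho> \<otimes> \<rho> x) = c \<tau> \<otimes> \<tau> x \<oplus> s x"
      unfolding s_def by (rule finsum_insert) (use insert(1,2) cc cl that in auto)
    then show ?thesis using insert(7)[OF that] by simp
  qed
  have S0: "c \<rho> = \<zero>" if "\<rho> \<in> S" for \<rho>
  proof -
    have "\<rho> \<noteq> \<tau>" using that insert(2) by auto
    moreover have "\<rho> \<in> extensional (carrier R)" "\<tau> \<in> extensional (carrier R)"
      using that insert(5) by auto
    ultimately have "\<not> (\<forall>y\<in>carrier R. \<rho> y = \<tau> y)"
      using extensionalityI[of \<rho> "carrier R" \<tau>] by metis
    then obtain y where y: "y \<in> carrier R" "\<rho> y \<noteq> \<tau> y" by blast
    \<comment> \<open>The relation at \<open>x y\<close> minus \<open>\<tau> y\<close> times the relation at \<open>x\<close> no longer involves \<open>\<tau>\<close>.\<close>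
    have "(\<Oplus>\<rho>\<in>S. (c \<rho> \<otimes> (\<rho> y \<ominus> \<tau> y)) \<otimes> \<rho> x) = \<zero>" if x: "x \<in> carrier R" for x
    proof -
      have "(\<Oplus>\<rho>\<in>S. (c \<rho> \<otimes> (\<rho> y \<ominus> \<tau> y)) \<otimes> \<rho> x)
          = (\<Oplus>\<rho>\<in>S. c \<rho> \<otimes> \<rho> (x \<otimes> y) \<oplus> (\<ominus> \<tau> y) \<otimes> (c \<rho> \<otimes> \<rho> x))"
      proof (rule finsum_cong'[OF refl])
        fix \<pi> assume "\<pi> \<in> S"
        then show "(c \<pi> \<otimes> (\<pi> y \<ominus> \<tau> y)) \<otimes> \<pi> x = c \<pi> \<otimes> \<pi> (x \<otimes> y) \<oplus> (\<ominus> \<tau> y) \<otimes> (c \<pi> \<otimes> \<pi> x)"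
          using x y cc[of \<pi>] cl[of \<pi> x] cl[of \<pi> y] cl[of \<tau> y] mul[of \<pi> x y]
          by (simp add: minus_eq l_distr r_distr l_minus r_minus m_ac)
      qed (use x y cc cl in auto)
      also have "\<dots> = s (x \<otimes> y) \<oplus> (\<Oplus>\<rho>\<in>S. (\<ominus> \<tau> y) \<otimes> (c \<rho> \<otimes> \<rho> x))"
        unfolding s_def by (rule finsum_addf) (use x y cc cl in auto)
      also have "(\<Oplus>\<rho>\<in>S. (\<ominus> \<tau> y) \<otimes> (c \<rho> \<otimes> \<rho> x)) = (\<ominus> \<tau> y) \<otimes> s x"
        unfolding s_def by (rule finsum_rdistr[symmetric]) (use insert(1) x y cc cl in auto)
      also have "s x = \<ominus> (c \<tau> \<otimes> \<tau> x)"
        using minus_equality[of "s x" "c \<tau> \<otimes> \<tau> x"] rel[OF x] s[OF x] cc[of \<tau>] cl[of \<tau> x] x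
        by (simp add: a_comm)
      also have "(\<ominus> \<tau> y) \<otimes> \<ominus> (c \<tau> \<otimes> \<tau> x) = c \<tau> \<otimes> \<tau> (x \<otimes> y)"
        using cc[of \<tau>] cl[of \<tau> x] cl[of \<tau> y] mul[of \<tau> x y] x y by (simp add: l_minus r_minus m_ac)
      also have "s (x \<otimes> y) \<oplus> c \<tau> \<otimes> \<tau> (x \<otimes> y) = \<zero>"
        using rel[of "x \<otimes> y"] s[of "x \<otimes> y"] cc[of \<tau>] cl[of \<tau>] x y by (simp add: a_comm)
      finally show ?thesis .
    qed
    then have "c \<rho> \<otimes> (\<rho> y \<ominus> \<tau> y) = \<zero>"
      using insert(3)[of "\<lambda>\<rho>. c \<rho> \<otimes> (\<rho> y \<ominus> \<tau> y)"] insert(4,5) cc cl y that by auto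
    moreover have "\<rho> y \<ominus> \<tau> y \<noteq> \<zero>"
      using y cl that by auto
    ultimately show ?thesis
      using integral[of "c \<rho>" "\<rho> y \<ominus> \<tau> y"] cc cl y that by auto
  qed
  have "s \<one> = (\<Oplus>\<rho>\<in>S. \<zero>)"
    unfolding s_def by (rule finsum_cong') (use S0 cl in auto)
  then have "c \<tau> = \<zero>" using rel[of \<one>] one[of \<tau>] cc[of \<tau>] by simp
  then show ?case using S0 by auto
qed

lemma ring_auto_group_carrier:
  "carrier (ring_auto_group R) = ring_iso R R \<inter> extensional (carrier R)"
  by (simp add: ring_auto_group_def)

lemma ring_iso_Bij: "ring_iso R R \<inter> extensional (carrier R) \<subseteq> Bij (carrier R)"
  by (auto simp: Bij_def ring_iso_def)

lemma ring_auto_group_mult: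
  assumes "\<tau> \<in> carrier (ring_auto_group R)" "\<rho> \<in> carrier (ring_auto_group R)"
  shows "\<tau> \<otimes>\<^bsub>ring_auto_group R\<^esub> \<rho> = compose (carrier R) \<tau> \<rho>"
  using assms ring_iso_Bij[of R] by (auto simp: ring_auto_group_def BijGroup_def)

lemma ring_auto_group_one: "\<one>\<^bsub>ring_auto_group R\<^esub> = (\<lambda>x\<in>carrier R. x)"
  by (simp add: ring_auto_group_def BijGroup_def)

lemma (in ring) ring_auto_group_is_group: "group (ring_auto_group R)"
proof (rule groupI)
  let ?A = "ring_auto_group R"
  have closed: "compose (carrier R) \<tau> \<rho> \<in> carrier ?A" if "\<tau> \<in> carrier ?A" "\<rho> \<in> carrier ?A" for \<tau> \<rho>
  proof -
    have "\<tau> \<circ> \<rho> \<in> ring_iso R R"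
      using that ring_iso_set_trans[of \<rho> R R \<tau> R] by (auto simp: ring_auto_group_carrier)
    then have "compose (carrier R) \<tau> \<rho> \<in> ring_iso R R"
      by (rule ring_iso_restrict) (simp add: compose_def)
    then show ?thesis by (simp add: ring_auto_group_carrier compose_def)
  qed
  have id: "(\<lambda>x\<in>carrier R. x) \<in> carrier ?A"
    unfolding ring_auto_group_carrier
    by (auto intro!: ring_iso_memI bij_betwI[where g = id])
  show "\<one>\<^bsub>?A\<^esub> \<in> carrier ?A" using id by (simp add: ring_auto_group_one)
  fix \<tau> assume \<tau>: "\<tau> \<in> carrier ?A"
  then have t: "\<tau> \<in> ring_iso R R" "\<tau> \<in> extensional (carrier R)"
    by (auto simp: ring_auto_group_carrier)
  show "\<one>\<^bsub>?A\<^esub> \<otimes>\<^bsub>?A\<^esub> \<tau> = \<tau>"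
    using \<tau> id t ring_iso_memE(1)[OF t(1)]
    by (simp add: ring_auto_group_one ring_auto_group_mult Id_compose Pi_I)
  show "\<exists>\<rho>\<in>carrier ?A. \<rho> \<otimes>\<^bsub>?A\<^esub> \<tau> = \<one>\<^bsub>?A\<^esub>"
  proof
    let ?i = "restrict (inv_into (carrier R) \<tau>) (carrier R)"
    have "inv_into (carrier R) \<tau> \<in> ring_iso R R"
      by (rule ring_iso_set_sym[OF ring_axioms t(1)])
    then have "?i \<in> ring_iso R R" by (rule ring_iso_restrict) simp
    then show i: "?i \<in> carrier ?A" by (simp add: ring_auto_group_carrier)
    have "\<tau> \<in> Bij (carrier R)" using \<tau> ring_iso_Bij by (auto simp: ring_auto_group_carrier)
    then show "?i \<otimes>\<^bsub>?A\<^esub> \<tau> = \<one>\<^bsub>?A\<^esub>"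
      using i \<tau> Bij_compose_restrict_eq by (simp add: ring_auto_group_mult ring_auto_group_one)
  qed
  fix \<rho> assume \<rho>: "\<rho> \<in> carrier ?A"
  show "\<tau> \<otimes>\<^bsub>?A\<^esub> \<rho> \<in> carrier ?A" using closed \<tau> \<rho> by (simp add: ring_auto_group_mult)
  fix \<pi> assume \<pi>: "\<pi> \<in> carrier ?A"
  have "\<pi> \<in> carrier R \<rightarrow> carrier R"
    using \<pi> ring_iso_memE(1)[of \<pi> R R] by (auto simp: ring_auto_group_carrier)
  then show "\<tau> \<otimes>\<^bsub>?A\<^esub> \<rho> \<otimes>\<^bsub>?A\<^esub> \<pi> = \<tau> \<otimes>\<^bsub>?A\<^esub> (\<rho> \<otimes>\<^bsub>?A\<^esub> \<pi>)"
    using \<tau> \<rho> \<pi> closed by (simp add: ring_auto_group_mult compose_assoc)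
qed

lemma ring_auto_group_memD:
  assumes "\<tau> \<in> carrier (ring_auto_group R)"
  shows "\<tau> \<in> ring_hom R R" and "\<tau> \<in> extensional (carrier R)"
    and "x \<in> carrier R \<Longrightarrow> \<tau> x \<in> carrier R"
  using assms ring_hom_memE(1)[of \<tau> R R] by (auto simp: ring_auto_group_carrier ring_iso_def)

lemma ring_auto_group_mult_apply:
  assumes "\<tau> \<in> carrier (ring_auto_group R)" "\<rho> \<in> carrier (ring_auto_group R)" "x \<in> carrier R"
  shows "(\<tau> \<otimes>\<^bsub>ring_auto_group R\<^esub> \<rho>) x = \<tau> (\<rho> x)"
  using assms by (simp add: ring_auto_group_mult compose_eq)

lemma (in group) left_mult_image_subgroup:
  assumes "subgroup H G" "finite H" "h \<in> H"
  shows "(\<otimes>) h ` H = H" and "inj_on ((\<otimes>) h) H"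
proof -
  have sub: "H \<subseteq> carrier G" using assms(1) by (rule subgroup.subset)
  show inj: "inj_on ((\<otimes>) h) H"
    using sub assms(3) by (auto intro!: inj_onI simp: subset_iff)
  show "(\<otimes>) h ` H = H"
    by (rule endo_inj_surj[OF assms(2) _ inj]) (use subgroup.m_closed[OF assms(1,3)] in auto)
qed

section \<open>Artin's theorem\<close>

lemma (in field) trace_fixed:
  assumes "subgroup \<Gamma> (ring_auto_group R)" "finite \<Gamma>" "\<rho> \<in> \<Gamma>" "y \<in> carrier R"
  shows "\<rho> (\<Oplus>\<tau>\<in>\<Gamma>. \<tau> y) = (\<Oplus>\<tau>\<in>\<Gamma>. \<tau> y)"
proof -
  let ?A = "ring_auto_group R"
  have A: "\<tau> \<in> carrier ?A" if "\<tau> \<in> \<Gamma>" for \<tau>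
    using that subgroup.subset[OF assms(1)] by blast
  have cl: "\<tau> y \<in> carrier R" if "\<tau> \<in> \<Gamma>" for \<tau>
    using ring_auto_group_memD(3)[OF A[OF that]] assms(4) by blast
  note image = group.left_mult_image_subgroup[OF ring_auto_group_is_group assms(1-3)]
  have "\<rho> (\<Oplus>\<tau>\<in>\<Gamma>. \<tau> y) = (\<Oplus>\<tau>\<in>\<Gamma>. \<rho> (\<tau> y))"
    by (rule endo_finsum) (use ring_auto_group_memD(1) A assms cl in auto)
  also have "\<dots> = (\<Oplus>\<tau>\<in>\<Gamma>. (\<rho> \<otimes>\<^bsub>?A\<^esub> \<tau>) y)"
    by (rule finsum_cong'[OF refl])
      (use A assms cl ring_auto_group_memD(3)[OF A[OF assms(3)]] in
        \<open>auto simp: ring_auto_group_mult_apply\<close>)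
  also have "\<dots> = (\<Oplus>\<tau>\<in>(\<otimes>\<^bsub>?A\<^esub>) \<rho> ` \<Gamma>. \<tau> y)"
    by (rule finsum_reindex[symmetric]) (use image cl in auto)
  also have "\<dots> = (\<Oplus>\<tau>\<in>\<Gamma>. \<tau> y)"
    unfolding image(1) ..
  finally show ?thesis .
qed

text \<open>More than \<open>card \<Gamma>\<close> elements are linearly dependent over the fixed field of \<open>\<Gamma>\<close>.\<close>

lemma (in field) fixed_field_relation:
  assumes \<Gamma>: "subgroup \<Gamma> (ring_auto_group R)" and fin: "finite \<Gamma>" "finite J"
    and card: "card \<Gamma> < card J" and x: "\<And>j. j \<in> J \<Longrightarrow> x j \<in> carrier R"
  shows "\<exists>f. (\<forall>j\<in>J. f j \<in> carrier R \<and> (\<forall>\<tau>\<in>\<Gamma>. \<tau> (f j) = f j)) \<and> (\<exists>j\<in>J. f j \<noteq> \<zero>) \<and>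
    (\<Oplus>j\<in>J. f j \<otimes> x j) = \<zero>"
proof -
  let ?A = "ring_auto_group R"
  interpret A: group ?A by (rule ring_auto_group_is_group)
  have A: "\<tau> \<in> carrier ?A" if "\<tau> \<in> \<Gamma>" for \<tau>
    using that subgroup.subset[OF \<Gamma>] by blast
  have hom: "\<tau> \<in> ring_hom R R" if "\<tau> \<in> \<Gamma>" for \<tau>
    using ring_auto_group_memD(1)[OF A[OF that]] .
  have cl: "\<tau> y \<in> carrier R" if "\<tau> \<in> \<Gamma>" "y \<in> carrier R" for \<tau> y
    using ring_hom_memE(1)[OF hom] that by blast
  define tr where "tr y = (\<Oplus>\<tau>\<in>\<Gamma>. \<tau> y)" for y
  have tr_cl: "tr y \<in> carrier R" if "y \<in> carrier R" for y
    unfolding tr_def by (rule finsum_closed) (use cl that in auto)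
  \<comment> \<open>The trace does not vanish identically, by the independence of the automorphisms.\<close>
  obtain y where y: "y \<in> carrier R" "tr y \<noteq> \<zero>"
  proof (rule ccontr)
    assume "\<not> thesis"
    with that have z: "tr y = \<zero>" if "y \<in> carrier R" for y using that by blast
    have "\<forall>\<tau>\<in>\<Gamma>. \<one> = \<zero>"
    proof (rule endomorphisms_independent[OF fin(1)])
      fix y assume y: "y \<in> carrier R"
      have "(\<Oplus>\<tau>\<in>\<Gamma>. \<one> \<otimes> \<tau> y) = tr y"
        unfolding tr_def by (rule finsum_cong') (use cl y in auto)
      then show "(\<Oplus>\<tau>\<in>\<Gamma>. \<one> \<otimes> \<tau> y) = \<zero>" using z[OF y] by simp
    qed (use hom ring_auto_group_memD(2) A in auto)
    moreover have "\<Gamma> \<noteq> {}" using subgroup.one_closed[OF \<Gamma>] by blast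
    ultimately show False using one_not_zero by auto
  qed
  obtain c where c: "\<forall>j\<in>J. c j \<in> carrier R" "\<exists>j\<in>J. c j \<noteq> \<zero>"
      "\<forall>\<tau>\<in>\<Gamma>. (\<Oplus>j\<in>J. c j \<otimes> \<tau> (x j)) = \<zero>"
    using homogeneous_system_solvable[OF fin card, of "\<lambda>\<tau> j. \<tau> (x j)"] cl x by blast
  then obtain j1 where j1: "j1 \<in> J" "c j1 \<noteq> \<zero>" by blast
  \<comment> \<open>Scale the solution so that its entry at \<open>j1\<close> has nonzero trace.\<close>
  define u where "u = y \<otimes> inv (c j1)"
  have inv: "inv (c j1) \<in> carrier R" "inv (c j1) \<otimes> c j1 = \<one>"
    using j1 c(1) field_Units by auto
  have u: "u \<in> carrier R" "u \<otimes> c j1 = y"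
    using y(1) inv j1 c(1) by (auto simp: u_def m_assoc)
  define b where "b j = u \<otimes> c j" for j
  have b: "b j \<in> carrier R" if "j \<in> J" for j
    using u(1) c(1) that by (simp add: b_def)
  \<comment> \<open>Apply \<open>\<rho>\<close> to the equation indexed by the inverse of \<open>\<rho>\<close>.\<close>
  have rel: "(\<Oplus>j\<in>J. \<rho> (b j) \<otimes> x j) = \<zero>" if \<rho>: "\<rho> \<in> \<Gamma>" for \<rho>
  proof -
    let ?i = "inv\<^bsub>?A\<^esub> \<rho>"
    have i: "?i \<in> \<Gamma>" using subgroup.m_inv_closed[OF \<Gamma> \<rho>] .
    have id: "\<rho> (?i z) = z" if "z \<in> carrier R" for z
      using ring_auto_group_mult_apply[OF A[OF \<rho>] A[OF i] that] A.r_inv[OF A[OF \<rho>]] that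
      by (simp add: ring_auto_group_one)
    have "(\<Oplus>j\<in>J. b j \<otimes> ?i (x j)) = (\<Oplus>j\<in>J. u \<otimes> (c j \<otimes> ?i (x j)))"
      by (rule finsum_cong') (use u c(1) cl[OF i] x in \<open>auto simp: b_def m_assoc\<close>)
    also have "\<dots> = u \<otimes> (\<Oplus>j\<in>J. c j \<otimes> ?i (x j))"
      by (rule finsum_rdistr[symmetric]) (use fin u c(1) cl[OF i] x in auto)
    finally have z: "(\<Oplus>j\<in>J. b j \<otimes> ?i (x j)) = \<zero>"
      using c(3) i u(1) by simp
    have "(\<Oplus>j\<in>J. \<rho> (b j) \<otimes> x j) = (\<Oplus>j\<in>J. \<rho> (b j \<otimes> ?i (x j)))"
    proof (rule finsum_cong'[OF refl])
      fix j assume j: "j \<in> J"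
      show "\<rho> (b j) \<otimes> x j = \<rho> (b j \<otimes> ?i (x j))"
        using ring_hom_memE(2)[OF hom[OF \<rho>], of "b j" "?i (x j)"] id[OF x[OF j]] b[OF j]
          cl[OF i x[OF j]] by simp
    qed (use cl[OF \<rho>] cl[OF i] b x in auto)
    also have "\<dots> = \<rho> (\<Oplus>j\<in>J. b j \<otimes> ?i (x j))"
      by (rule endo_finsum[symmetric]) (use fin hom[OF \<rho>] cl[OF i] b x in auto)
    also have "\<dots> = \<zero>"
      unfolding z by (rule ring_hom_zero[OF hom[OF \<rho>] ring_axioms ring_axioms])
    finally show ?thesis .
  qed
  have "(\<Oplus>j\<in>J. tr (b j) \<otimes> x j) = (\<Oplus>j\<in>J. \<Oplus>\<rho>\<in>\<Gamma>. \<rho> (b j) \<otimes> x j)"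
    by (rule finsum_cong'[OF refl])
      (use fin cl b x in \<open>auto simp: tr_def Pi_def intro!: finsum_ldistr finsum_closed\<close>)
  also have "\<dots> = (\<Oplus>\<rho>\<in>\<Gamma>. \<Oplus>j\<in>J. \<rho> (b j) \<otimes> x j)"
    by (rule finsum_swap) (use fin cl b x in auto)
  also have "\<dots> = (\<Oplus>\<rho>\<in>\<Gamma>. \<zero>)"
    by (rule finsum_cong') (use rel in auto)
  finally have "(\<Oplus>j\<in>J. tr (b j) \<otimes> x j) = \<zero>" by simp
  moreover have "tr (b j1) \<noteq> \<zero>" using y(2) u(2) by (simp add: b_def)
  moreover have "\<tau> (tr (b j)) = tr (b j)" if "\<tau> \<in> \<Gamma>" "j \<in> J" for \<tau> j
    unfolding tr_def using trace_fixed[OF \<Gamma> fin(1) that(1)] b that by blast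
  ultimately show ?thesis
    using tr_cl b j1(1) by (intro exI[of _ "\<lambda>j. tr (b j)"]) blast
qed

text \<open>
  If the whole field is spanned over \<open>F\<close> by the \<open>e j\<close>, there are at most \<open>card J\<close> automorphisms fixing
  \<open>F\<close>: a linear relation between them need only hold at the \<open>e j\<close>.
\<close>

lemma (in field) card_automorphisms_le:
  assumes fin: "finite S" "finite J" and S: "S \<subseteq> carrier (ring_auto_group R)"
    and F: "F \<subseteq> carrier R" "\<And>\<tau> x. \<tau> \<in> S \<Longrightarrow> x \<in> F \<Longrightarrow> \<tau> x = x"
    and e: "\<And>j. j \<in> J \<Longrightarrow> e j \<in> carrier R"
    and span: "\<And>x. x \<in> carrier R \<Longrightarrow> \<exists>f. (\<forall>j\<in>J. f j \<in> F) \<and> x = (\<Oplus>j\<in>J. f j \<otimes> e j)"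
  shows "card S \<le> card J"
proof (rule ccontr)
  assume "\<not> card S \<le> card J"
  then have less: "card J < card S" by simp
  have hom: "\<tau> \<in> ring_hom R R" if "\<tau> \<in> S" for \<tau>
    using ring_auto_group_memD(1) S that by blast
  have cl: "\<tau> y \<in> carrier R" if "\<tau> \<in> S" "y \<in> carrier R" for \<tau> y
    using ring_hom_memE(1)[OF hom] that by blast
  obtain c where c: "\<forall>\<tau>\<in>S. c \<tau> \<in> carrier R" "\<exists>\<tau>\<in>S. c \<tau> \<noteq> \<zero>"
      "\<forall>j\<in>J. (\<Oplus>\<tau>\<in>S. c \<tau> \<otimes> \<tau> (e j)) = \<zero>"
    using homogeneous_system_solvable[OF fin(2,1) less, of "\<lambda>j \<tau>. \<tau> (e j)"] cl e by blast
  have "\<forall>\<tau>\<in>S. c \<tau> = \<zero>"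
  proof (rule endomorphisms_independent[OF fin(1)])
    fix x assume "x \<in> carrier R"
    then obtain f where f: "\<forall>j\<in>J. f j \<in> F" "x = (\<Oplus>j\<in>J. f j \<otimes> e j)" using span by blast
    have fc: "f j \<in> carrier R" if "j \<in> J" for j using f F that by blast
    have "(\<Oplus>\<tau>\<in>S. c \<tau> \<otimes> \<tau> x) = (\<Oplus>\<tau>\<in>S. \<Oplus>j\<in>J. f j \<otimes> (c \<tau> \<otimes> \<tau> (e j)))"
    proof (rule finsum_cong'[OF refl])
      fix \<tau> assume \<tau>: "\<tau> \<in> S"
      have "\<tau> x = (\<Oplus>j\<in>J. \<tau> (f j \<otimes> e j))"
        unfolding f(2) by (rule endo_finsum) (use hom[OF \<tau>] fin fc e in auto)
      also have "\<dots> = (\<Oplus>j\<in>J. f j \<otimes> \<tau> (e j))"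
        by (rule finsum_cong'[OF refl])
          (use ring_hom_memE(2)[OF hom[OF \<tau>]] F(2)[OF \<tau>] f(1) fc e cl[OF \<tau>] in auto)
      finally have "c \<tau> \<otimes> \<tau> x = (\<Oplus>j\<in>J. c \<tau> \<otimes> (f j \<otimes> \<tau> (e j)))"
        using finsum_rdistr[OF fin(2), of "c \<tau>" "\<lambda>j. f j \<otimes> \<tau> (e j)"] c(1) \<tau> fc e cl[OF \<tau>] by auto
      also have "\<dots> = (\<Oplus>j\<in>J. f j \<otimes> (c \<tau> \<otimes> \<tau> (e j)))"
        by (rule finsum_cong'[OF refl]) (use c(1) \<tau> fc e cl[OF \<tau>] m_lcomm in auto)
      finally show "c \<tau> \<otimes> \<tau> x = (\<Oplus>j\<in>J. f j \<otimes> (c \<tau> \<otimes> \<tau> (e j)))" .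
    qed (use c fc e cl in \<open>auto intro!: finsum_closed\<close>)
    also have "\<dots> = (\<Oplus>j\<in>J. \<Oplus>\<tau>\<in>S. f j \<otimes> (c \<tau> \<otimes> \<tau> (e j)))"
      by (rule finsum_swap) (use fin c fc e cl in auto)
    also have "\<dots> = (\<Oplus>j\<in>J. \<zero>)"
    proof (rule finsum_cong'[OF refl])
      fix j assume j: "j \<in> J"
      have "(\<Oplus>\<tau>\<in>S. f j \<otimes> (c \<tau> \<otimes> \<tau> (e j))) = f j \<otimes> (\<Oplus>\<tau>\<in>S. c \<tau> \<otimes> \<tau> (e j))"
        by (rule finsum_rdistr[symmetric]) (use fin c fc e cl j in auto)
      then show "(\<Oplus>\<tau>\<in>S. f j \<otimes> (c \<tau> \<otimes> \<tau> (e j))) = \<zero>" using c(3) fc j by simp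
    qed auto
    finally show "(\<Oplus>\<tau>\<in>S. c \<tau> \<otimes> \<tau> x) = \<zero>" by simp
  qed (use hom S ring_auto_group_memD(2) c in auto)
  then show False using c(2) by blast
qed

lemma (in ring) combine_eq_finsum:
  assumes "length Ks = length Us" "set Ks \<subseteq> carrier R" "set Us \<subseteq> carrier R"
  shows "combine Ks Us = (\<Oplus>i\<in>{..<length Us}. Ks ! i \<otimes> Us ! i)"
  using assms
proof (induct Ks Us rule: list_induct2)
  case Nil
  then show ?case by simp
next
  case (Cons k Ks u Us)
  have c: "Ks ! i \<in> carrier R" "Us ! i \<in> carrier R" if "i < length Us" for i
    using Cons that nth_mem[of i Ks] nth_mem[of i Us] by auto
  have "(\<Oplus>i\<in>{..<Suc (length Us)}. (k # Ks) ! i \<otimes> (u # Us) ! i)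
      = k \<otimes> u \<oplus> (\<Oplus>i\<in>Suc ` {..<length Us}. (k # Ks) ! i \<otimes> (u # Us) ! i)"
    unfolding lessThan_Suc_eq_insert_0
    by (subst finsum_insert) (use Cons c in auto)
  also have "(\<Oplus>i\<in>Suc ` {..<length Us}. (k # Ks) ! i \<otimes> (u # Us) ! i)
      = (\<Oplus>i\<in>{..<length Us}. Ks ! i \<otimes> Us ! i)"
    by (subst finsum_reindex) (use c in auto)
  finally show ?case using Cons by simp
qed

lemma (in ring) combine_subring:
  assumes "subring K R"
  shows "ring.combine (R\<lparr>carrier := K\<rparr>) Ks Us = combine Ks Us"
proof -
  interpret K: ring "R\<lparr>carrier := K\<rparr>" by (rule subring_is_ring[OF assms])
  show ?thesis
    by (induct Ks Us rule: combine.induct) auto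
qed

text \<open>
  Artin's theorem for subfields \<open>F \<subseteq> C\<close> of an ambient ring, \<open>F\<close> being the fixed field of a finite group
  \<open>\<Gamma>\<close> of automorphisms of \<open>C\<close>.
\<close>

theorem (in ring) artin:
  assumes C: "subfield C R" and F: "subfield F R"
    and \<Gamma>: "subgroup \<Gamma> (ring_auto_group (R\<lparr>carrier := C\<rparr>))" and fin: "finite \<Gamma>"
    and fixed: "F = {x \<in> C. \<forall>\<tau>\<in>\<Gamma>. \<tau> x = x}"
  shows "dimension (card \<Gamma>) F C" and "carrier (galois_group R C F) = \<Gamma>"
proof -
  let ?K = "R\<lparr>carrier := C\<rparr>"
  interpret K: field ?K by (rule subfield_iff(2)[OF C])
  have sub: "subring C R" by (rule subfieldE(1)[OF C])
  have FC: "F \<subseteq> C" and CR: "C \<subseteq> carrier R" using fixed subfieldE(3)[OF C] by auto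
  have comb: "combine Ks Us = (\<Oplus>\<^bsub>?K\<^esub>i\<in>{..<length Us}. Ks ! i \<otimes> Us ! i)"
    if "length Ks = length Us" "set Ks \<subseteq> C" "set Us \<subseteq> C" for Ks Us
    using K.combine_eq_finsum[of Ks Us] combine_subring[OF sub] that by simp
  have bound: "length Us \<le> card \<Gamma>" if Us: "independent F Us" "set Us \<subseteq> C" for Us
  proof (rule ccontr)
    assume "\<not> length Us \<le> card \<Gamma>"
    then have "card \<Gamma> < card {..<length Us}" by simp
    then obtain f where f: "\<forall>j\<in>{..<length Us}. f j \<in> C \<and> (\<forall>\<tau>\<in>\<Gamma>. \<tau> (f j) = f j)"
        "\<exists>j\<in>{..<length Us}. f j \<noteq> \<zero>" "(\<Oplus>\<^bsub>?K\<^esub>j\<in>{..<length Us}. f j \<otimes> Us ! j) = \<zero>"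
      using K.fixed_field_relation[OF \<Gamma> fin, of "{..<length Us}" "\<lambda>j. Us ! j"] Us(2)
      by (auto simp: subset_iff)
    define Ks where "Ks = map f [0..<length Us]"
    have KF: "set Ks \<subseteq> F" and Kl: "length Ks = length Us" using f(1) fixed by (auto simp: Ks_def)
    have "combine Ks Us = (\<Oplus>\<^bsub>?K\<^esub>i\<in>{..<length Us}. Ks ! i \<otimes> Us ! i)"
      using KF FC Us(2) Kl by (intro comb) auto
    also have "\<dots> = (\<Oplus>\<^bsub>?K\<^esub>j\<in>{..<length Us}. f j \<otimes> Us ! j)"
      by (rule K.finsum_cong'[OF refl])
        (use f(1) Us(2) subringE(6)[OF sub] in \<open>auto simp: Ks_def subset_iff\<close>)
    finally have "combine Ks Us = \<zero>" using f(3) by simp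
    then have "set (take (length Us) Ks) \<subseteq> {\<zero>}"
      by (rule independent_imp_trivial_combine[OF F Us(1) KF])
    moreover have "take (length Us) Ks = Ks" using Kl by simp
    ultimately show False using f(2) by (auto simp: Ks_def image_subset_iff)
  qed
  \<comment> \<open>By \<open>bound\<close> there is an independent list in \<open>C\<close> of greatest length; it is a basis.\<close>
  define P where "P l \<longleftrightarrow> (\<exists>Us. independent F Us \<and> set Us \<subseteq> C \<and> length Us = l)" for l
  have "P 0" unfolding P_def by (intro exI[of _ "[]"]) auto
  then have "P (Greatest P)" and greatest: "\<And>l. P l \<Longrightarrow> l \<le> Greatest P"
    using GreatestI_nat[of P 0 "card \<Gamma>"] Greatest_le_nat[of P _ "card \<Gamma>"] bound
    by (auto simp: P_def)
  then obtain Us where Us: "independent F Us" "set Us \<subseteq> C" "length Us = Greatest P"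
    unfolding P_def by blast
  have UR: "set Us \<subseteq> carrier R" using Us CR by auto
  have span: "Span F Us = C"
  proof
    show "Span F Us \<subseteq> C"
    proof
      fix x assume "x \<in> Span F Us"
      then obtain Ks where Ks: "set Ks \<subseteq> F" "length Ks = length Us" "x = combine Ks Us"
        using Span_mem_iff_length_version[OF F UR] by blast
      have "K.combine Ks Us \<in> carrier ?K"
        by (rule K.combine_in_carrier) (use Ks FC Us in auto)
      then show "x \<in> C" using Ks(3) combine_subring[OF sub] by simp
    qed
    show "C \<subseteq> Span F Us"
    proof
      fix x assume x: "x \<in> C"
      show "x \<in> Span F Us"
      proof (rule ccontr)
        assume "x \<notin> Span F Us"
        then have "independent F (x # Us)" using x CR Us by (intro li_Cons) auto
        then have "P (Suc (length Us))" unfolding P_def using x Us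
          by (intro exI[of _ "x # Us"]) auto
        then show False using greatest Us(3) by fastforce
      qed
    qed
  qed
  have le: "card S \<le> length Us"
    if S: "finite S" "S \<subseteq> carrier (ring_auto_group ?K)" "\<And>\<tau> x. \<tau> \<in> S \<Longrightarrow> x \<in> F \<Longrightarrow> \<tau> x = x" for S
  proof -
    have "card S \<le> card {..<length Us}"
    proof (rule K.card_automorphisms_le[where S = S and F = F and e = "\<lambda>j. Us ! j"])
      fix x assume "x \<in> carrier ?K"
      then have "x \<in> Span F Us" using span by simp
      then obtain Ks where Ks: "set Ks \<subseteq> F" "length Ks = length Us" "x = combine Ks Us"
        using Span_mem_iff_length_version[OF F UR] by blast
      then show "\<exists>f. (\<forall>j\<in>{..<length Us}. f j \<in> F) \<and> x = (\<Oplus>\<^bsub>?K\<^esub>j\<in>{..<length Us}. f j \<otimes>\<^bsub>?K\<^esub> Us ! j)"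
        using comb[of Ks Us] FC Us(2) by (intro exI[of _ "\<lambda>i. Ks ! i"]) auto
    qed (use S FC Us(2) in auto)
    then show ?thesis by simp
  qed
  have \<Gamma>A: "\<Gamma> \<subseteq> carrier (ring_auto_group ?K)" using subgroup.subset[OF \<Gamma>] .
  have \<Gamma>F: "\<And>\<tau> x. \<tau> \<in> \<Gamma> \<Longrightarrow> x \<in> F \<Longrightarrow> \<tau> x = x" using fixed by auto
  have len: "length Us = card \<Gamma>"
    using bound[OF Us(1,2)] le[of \<Gamma>] fin \<Gamma>A \<Gamma>F by fastforce
  show "dimension (card \<Gamma>) F C"
    using dimension_independent[OF Us(1)] span len by simp
  show "carrier (galois_group R C F) = \<Gamma>"
  proof
    show "\<Gamma> \<subseteq> carrier (galois_group R C F)"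
      using \<Gamma>A \<Gamma>F by (auto simp: galois_group_def)
    show "carrier (galois_group R C F) \<subseteq> \<Gamma>"
    proof
      fix \<tau> assume \<tau>: "\<tau> \<in> carrier (galois_group R C F)"
      show "\<tau> \<in> \<Gamma>"
      proof (rule ccontr)
        assume "\<tau> \<notin> \<Gamma>"
        then have "card (insert \<tau> \<Gamma>) = Suc (card \<Gamma>)" using fin by simp
        moreover have "card (insert \<tau> \<Gamma>) \<le> length Us"
          by (rule le) (use \<tau> fin \<Gamma>A \<Gamma>F in \<open>auto simp: galois_group_def\<close>)
        ultimately show False using len by simp
      qed
    qed
  qed
qed

section \<open>Automorphisms, centers and fixed points\<close>

lemma funpow_fixes_iff:
  fixes f :: "'a \<Rightarrow> 'a"
  assumes "0 < m" "(f ^^ m) x = x"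
  shows "\<exists>s>0. \<forall>i. (f ^^ i) x = x \<longleftrightarrow> s dvd i"
proof -
  define s where "s = (LEAST s. 0 < s \<and> (f ^^ s) x = x)"
  have s: "0 < s" "(f ^^ s) x = x"
    using LeastI[of "\<lambda>s. 0 < s \<and> (f ^^ s) x = x" m] assms unfolding s_def by auto
  have mult: "((f ^^ s) ^^ q) x = x" for q
    by (induct q) (use s(2) in auto)
  have "(f ^^ i) x = x \<longleftrightarrow> s dvd i" for i
  proof -
    have "(f ^^ i) x = (f ^^ (i mod s + s * (i div s))) x" by simp
    also have "\<dots> = (f ^^ (i mod s)) (((f ^^ s) ^^ (i div s)) x)"
      unfolding funpow_add funpow_mult by (simp add: mult.commute)
    finally have red: "(f ^^ i) x = (f ^^ (i mod s)) x" unfolding mult .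
    show ?thesis
    proof
      assume "(f ^^ i) x = x"
      then have "(f ^^ (i mod s)) x = x" using red by simp
      then have "\<not> 0 < i mod s"
        using not_less_Least[of "i mod s" "\<lambda>s. 0 < s \<and> (f ^^ s) x = x"] s(1)
        unfolding s_def[symmetric] by auto
      then show "s dvd i" by auto
    next
      assume "s dvd i"
      then show "(f ^^ i) x = x" using red by simp
    qed
  qed
  then show ?thesis using s(1) by blast
qed

lemma (in ring) ring_iso_center:
  assumes h: "h \<in> ring_iso R R"
  shows "h ` ring_center R = ring_center R"
proof -
  note hom = ring_iso_memE[OF h]
  have onto: "\<exists>z\<in>carrier R. y = h z" if "y \<in> carrier R" for y
    using hom(5) that unfolding bij_betw_def by blast
  have inj: "\<And>x y. x \<in> carrier R \<Longrightarrow> y \<in> carrier R \<Longrightarrow> h x = h y \<Longrightarrow> x = y"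
    using hom(5) unfolding bij_betw_def inj_on_def by blast
  show ?thesis
  proof
    show "h ` ring_center R \<subseteq> ring_center R"
    proof (rule image_subsetI)
      fix x assume x: "x \<in> ring_center R"
      then have xc: "x \<in> carrier R" by (simp add: ring_center_def)
      have "h x \<otimes> y = y \<otimes> h x" if y: "y \<in> carrier R" for y
      proof -
        obtain z where z: "z \<in> carrier R" "y = h z" using onto[OF y] by blast
        have "x \<otimes> z = z \<otimes> x" using x z(1) by (simp add: ring_center_def)
        then show ?thesis unfolding z(2) using hom(2)[OF xc z(1)] hom(2)[OF z(1) xc] by simp
      qed
      then show "h x \<in> ring_center R" using hom(1)[OF xc] by (simp add: ring_center_def)
    qed
    show "ring_center R \<subseteq> h ` ring_center R"
    proof
      fix x assume x: "x \<in> ring_center R"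
      then have xc: "x \<in> carrier R" by (simp add: ring_center_def)
      obtain z where z: "z \<in> carrier R" "x = h z" using onto[OF xc] by blast
      have "z \<otimes> w = w \<otimes> z" if w: "w \<in> carrier R" for w
      proof (rule inj)
        have "x \<otimes> h w = h w \<otimes> x" using x hom(1)[OF w] by (simp add: ring_center_def)
        then show "h (z \<otimes> w) = h (w \<otimes> z)" using hom(2) z w by simp
      qed (use z w in auto)
      then have "z \<in> ring_center R" using z(1) by (simp add: ring_center_def)
      then show "x \<in> h ` ring_center R" using z(2) by blast
    qed
  qed
qed

lemma (in ring) subfield_fixed_points:
  assumes C: "subfield C R" and h: "h \<in> ring_hom R R"
  shows "subfield ({x \<in> carrier R. h x = x} \<inter> C) R" (is "subfield ?F R")
proof (rule subfieldI)
  note hom = ring_hom_memE[OF h]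
  note Cs = subringE[OF subfieldE(1)[OF C]]
  have CR: "C \<subseteq> carrier R" by (rule subfieldE(3)[OF C])
  have neg: "h (\<ominus> x) = \<ominus> h x" if "x \<in> carrier R" for x
  proof -
    have "h (\<ominus> x) \<oplus> h x = h (\<ominus> x \<oplus> x)" using hom(3) that by simp
    also have "\<dots> = \<zero>"
      using that ring_hom_zero[OF h ring_axioms ring_axioms] by (simp add: l_neg)
    finally show ?thesis using minus_equality hom(1) that by simp
  qed
  have "subring ?F R"
    by (rule subringI) (use hom neg Cs CR in auto)
  then show F: "subcring ?F R"
    by (rule subcringI) (use subfieldE(4)[OF C] in auto)
  show "Units (R\<lparr>carrier := ?F\<rparr>) = ?F - {\<zero>}"
  proof
    show "Units (R\<lparr>carrier := ?F\<rparr>) \<subseteq> ?F - {\<zero>}"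
      using subfieldE(6)[OF C] by (auto simp: Units_def)
    show "?F - {\<zero>} \<subseteq> Units (R\<lparr>carrier := ?F\<rparr>)"
    proof
      fix x assume x: "x \<in> ?F - {\<zero>}"
      then have xC: "x \<in> C - {\<zero>}" and xR: "x \<in> carrier R" and hx: "h x = x" by auto
      note i = subfield_m_inv[OF C xC]
      have iR: "inv x \<in> carrier R" using i(1) CR by auto
      have "inv x \<otimes> x \<otimes> h (inv x) = inv x \<otimes> h (x \<otimes> inv x)"
        using hom(2)[OF xR iR] hom(1)[OF iR] iR xR hx by (simp add: m_assoc)
      then have "h (inv x) = inv x"
        using i hom(1)[OF iR] hom(4) iR by simp
      then have "inv x \<in> ?F" using i(1) iR by simp
      then show "x \<in> Units (R\<lparr>carrier := ?F\<rparr>)"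
        using x i by (auto simp: Units_def intro!: bexI[of _ "inv x"])
    qed
  qed
qed

section \<open>Right nuclei of generalized cyclic algebras\<close>

theorem theorem7:
  fixes D :: "('a, 'b) ring_scheme"
    and C F :: "'a set"
    and \<sigma> \<gamma> :: "'a \<Rightarrow> 'a"
    and n m :: nat
    and d :: 'a
    and G :: "('a \<Rightarrow> 'a) monoid"
    and H :: "('a \<Rightarrow> 'a) set"
    and A :: "('a, nat \<Rightarrow> 'a) up_ring"
  assumes "central_division_algebra D C n"
    and "\<sigma> \<in> ring_iso D D"
    and "\<gamma> = restrict \<sigma> C"
    and "m > 0"
    and "group.ord (ring_auto_group (D\<lparr>carrier := C\<rparr>)) \<gamma> = m"
    and "F = {x \<in> carrier D. \<sigma> x = x} \<inter> C"
    and "d \<in> C - F"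
    and "G = galois_group D C F"
    and "H = {\<tau> \<in> carrier G. \<tau> d = d}"
    and "A = gen_cyclic_algebra D \<sigma> m d"
  shows "galois_extension D F C \<and> ring.dimension D m F C \<and>
    cyclic_group G \<and> carrier G = generate G {\<gamma>} \<and>
    (\<exists>s r. m = s * r \<and> H = generate G {\<gamma> [^]\<^bsub>G\<^esub> s} \<and>
      ((\<forall>a \<in> carrier D. (\<sigma> ^^ m) a = a) \<longrightarrow>
        right_nucleus A = {g \<in> carrier A. \<forall>i. \<not> s dvd i \<longrightarrow> g i = \<zero>\<^bsub>D\<^esub>} \<and>
        (let P = skew_poly D (\<sigma> ^^ s);
             I = genideal P {skew_binomial D (\<sigma> ^^ s) r d}
         in \<exists>\<Phi> \<in> ring_iso (P Quot I) (A\<lparr>carrier := right_nucleus A\<rparr>).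
              \<forall>p \<in> carrier P. deg D p < r \<longrightarrow> \<Phi> (I +>\<^bsub>P\<^esub> p) = subst_power D s p))) \<and>
    ((\<forall>a \<in> carrier D. (\<sigma> ^^ m) a = a) \<and> Factorial_Ring.prime m \<longrightarrow>
      right_nucleus A = (\<lambda>a. monom A a 0) ` carrier D)"
proof -
  let ?K = "D\<lparr>carrier := C\<rparr>"
  let ?B = "ring_auto_group ?K"
  have cda: "ring D" "Units D = carrier D - {\<zero>\<^bsub>D\<^esub>}" "C = ring_center D" "subfield C D"
    using assms(1) unfolding central_division_algebra_def central_division_algebra_axioms_def by blast+
  interpret D: ring D by (rule cda(1))
  interpret K: field ?K by (rule D.subfield_iff(2)[OF cda(4)])
  interpret B: group ?B by (rule K.ring_auto_group_is_group)
  note hom = ring_iso_memE[OF assms(2)]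
  have \<sigma>hom: "\<sigma> \<in> ring_hom D D" using assms(2) by (simp add: ring_iso_def)
  have CD: "C \<subseteq> carrier D" by (rule subfieldE(3)[OF cda(4)])
  have \<sigma>C: "\<sigma> ` C = C" using D.ring_iso_center[OF assms(2)] cda(3) by simp
  have F: "subfield F D" unfolding assms(6) by (rule D.subfield_fixed_points[OF cda(4) \<sigma>hom])

  have "\<sigma> \<in> ring_iso ?K ?K"
    using \<sigma>C hom(5) CD by (intro ring_iso_memI) (auto simp: subset_iff hom(2-4) bij_betw_def inj_on_def)
  then have "\<gamma> \<in> ring_iso ?K ?K"
    by (rule K.ring_iso_restrict) (simp add: assms(3))
  then have \<gamma>: "\<gamma> \<in> carrier ?B"
    by (simp add: ring_auto_group_carrier assms(3))
  have pow_C: "(\<sigma> ^^ i) x \<in> C" if "x \<in> C" for i x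
    by (induct i) (use that \<sigma>C in auto)
  have pow: "(\<gamma> [^]\<^bsub>?B\<^esub> i) x = (\<sigma> ^^ i) x" if "x \<in> C" for i :: nat and x
    using that
  proof (induct i arbitrary: x)
    case 0
    then show ?case by (simp add: ring_auto_group_one)
  next
    case (Suc i)
    have "(\<gamma> [^]\<^bsub>?B\<^esub> Suc i) x = (\<gamma> [^]\<^bsub>?B\<^esub> i) (\<gamma> x)"
      using Suc(2) \<gamma> by (simp add: ring_auto_group_mult_apply)
    also have "\<dots> = (\<sigma> ^^ i) (\<sigma> x)"
    proof -
      have "\<sigma> x \<in> C" "\<gamma> x = \<sigma> x" using Suc(2) \<sigma>C by (auto simp: assms(3))
      then show ?thesis using Suc(1)[of "\<sigma> x"] by simp
    qed
    finally show ?case by (simp add: funpow_swap1)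
  qed
  define \<Gamma> where "\<Gamma> = generate ?B {\<gamma>}"
  have ord: "B.ord \<gamma> = m" by (rule assms(5))
  have \<Gamma>_pow: "\<Gamma> = {\<gamma> [^]\<^bsub>?B\<^esub> k | k. k \<in> (UNIV :: nat set)}"
    unfolding \<Gamma>_def by (rule B.generate_pow_nat[OF \<gamma>]) (use ord assms(4) in simp)
  have card: "card \<Gamma> = m" unfolding \<Gamma>_def using B.generate_pow_card[OF \<gamma>] ord by simp
  then have fin: "finite \<Gamma>" using assms(4) by (intro card_ge_0_finite) simp
  have sub\<Gamma>: "subgroup \<Gamma> ?B" unfolding \<Gamma>_def by (rule B.generate_is_subgroup) (use \<gamma> in simp)
  have \<gamma>\<Gamma>: "\<gamma> \<in> \<Gamma>" unfolding \<Gamma>_def by (rule generate.incl) simp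
  have F_fixed: "F = {x \<in> C. \<forall>\<tau>\<in>\<Gamma>. \<tau> x = x}"
  proof
    show "F \<subseteq> {x \<in> C. \<forall>\<tau>\<in>\<Gamma>. \<tau> x = x}"
    proof
      fix x assume x: "x \<in> F"
      then have "(\<sigma> ^^ k) x = x" for k by (induct k) (auto simp: assms(6))
      then show "x \<in> {x \<in> C. \<forall>\<tau>\<in>\<Gamma>. \<tau> x = x}"
        using x pow[of x] by (auto simp: \<Gamma>_pow assms(6))
    qed
    show "{x \<in> C. \<forall>\<tau>\<in>\<Gamma>. \<tau> x = x} \<subseteq> F"
      using \<gamma>\<Gamma> CD by (auto simp: assms(3,6))
  qed
  note artin = D.artin[OF cda(4) F sub\<Gamma> fin F_fixed]
  have dim: "ring.dimension D m F C" using artin(1) card by simp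
  have carG: "carrier G = \<Gamma>" unfolding assms(8) by (rule artin(2))
  have G: "G = ?B\<lparr>carrier := \<Gamma>\<rparr>" using carG unfolding assms(8) galois_group_def by simp
  have groupG: "group G" unfolding G by (rule subgroup.subgroup_is_group[OF sub\<Gamma> B.group_axioms])
  have powG: "\<gamma> [^]\<^bsub>G\<^esub> (i::nat) = \<gamma> [^]\<^bsub>?B\<^esub> i" for i
    unfolding G by (rule B.nat_pow_consistent[symmetric])
  have genG: "carrier G = generate G {\<gamma>}"
    unfolding carG using B.generate_consistent[of "{\<gamma>}" \<Gamma>] \<gamma>\<Gamma> sub\<Gamma> by (simp add: G \<Gamma>_def)
  have galois: "galois_extension D F C"
    unfolding galois_extension_def
    using F cda(4) D.finite_dimensionI[OF dim] carG F_fixed assms(8) by auto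
  have cyclic: "cyclic_group G"
    unfolding cyclic_group_def
  proof
    show \<gamma>G: "\<gamma> \<in> carrier G" using \<gamma>\<Gamma> carG by simp
    show "subgroup_generated G {\<gamma>} = G"
      using \<gamma>G genG by (simp add: subgroup_generated_def)
  qed

  have dC: "d \<in> C" and dD: "d \<in> carrier D" and d_moved: "\<sigma> d \<noteq> d"
    using assms(6,7) CD by auto
  have pow_m: "\<gamma> [^]\<^bsub>?B\<^esub> m = \<one>\<^bsub>?B\<^esub>" using B.pow_ord_eq_1[OF \<gamma>] ord by simp
  then have "(\<sigma> ^^ m) d = d" using pow[OF dC, of m] dC by (simp add: ring_auto_group_one)
  \<comment> \<open>\<open>s\<close> is the length of the orbit of \<open>d\<close> under \<open>\<sigma>\<close>.\<close>
  then obtain s where s: "0 < s" "\<And>i. (\<sigma> ^^ i) d = d \<longleftrightarrow> s dvd i"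
    using funpow_fixes_iff[OF assms(4)] by metis
  have "s dvd m" using s(2) \<open>(\<sigma> ^^ m) d = d\<close> by simp
  then obtain r where r: "m = s * r" by blast
  have s_ne: "s \<noteq> 1" using s(2)[of 1] d_moved by auto
  then have m2: "2 \<le> m" using \<open>s dvd m\<close> s(1) assms(4) dvd_imp_le[of s m] by linarith
  have fix_pow: "(\<gamma> [^]\<^bsub>?B\<^esub> k) d = d \<longleftrightarrow> s dvd k" for k :: nat
    using pow[OF dC] s(2) by simp
  have H: "H = generate G {\<gamma> [^]\<^bsub>G\<^esub> s}"
  proof -
    let ?g = "\<gamma> [^]\<^bsub>?B\<^esub> s"
    have g: "?g \<in> carrier ?B" "?g \<in> \<Gamma>" using \<gamma> \<Gamma>_pow by auto
    have "?g [^]\<^bsub>?B\<^esub> m = \<one>\<^bsub>?B\<^esub>"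
      using B.nat_pow_pow[OF \<gamma>, of s m] B.nat_pow_pow[OF \<gamma>, of m s] pow_m
      by (simp add: mult.commute B.nat_pow_one)
    then have "B.ord ?g dvd m" using B.pow_eq_id[OF g(1)] by simp
    then have "B.ord ?g \<noteq> 0" using assms(4) by auto
    then have "generate ?B {?g} = {?g [^]\<^bsub>?B\<^esub> k | k. k \<in> (UNIV :: nat set)}"
      by (rule B.generate_pow_nat[OF g(1)])
    also have "\<dots> = {\<gamma> [^]\<^bsub>?B\<^esub> (s * k) | k. k \<in> (UNIV :: nat set)}"
      by (simp add: B.nat_pow_pow[OF \<gamma>])
    also have "\<dots> = {\<tau> \<in> \<Gamma>. \<tau> d = d}"
    proof (intro subset_antisym subsetI)
      fix \<tau> assume "\<tau> \<in> {\<gamma> [^]\<^bsub>?B\<^esub> (s * k) | k. k \<in> (UNIV :: nat set)}"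
      then obtain k where k: "\<tau> = \<gamma> [^]\<^bsub>?B\<^esub> (s * k)" by blast
      have "\<tau> \<in> \<Gamma>" unfolding k \<Gamma>_pow by blast
      moreover have "\<tau> d = d" unfolding k using fix_pow[of "s * k"] by simp
      ultimately show "\<tau> \<in> {\<tau> \<in> \<Gamma>. \<tau> d = d}" by simp
    next
      fix \<tau> assume \<tau>: "\<tau> \<in> {\<tau> \<in> \<Gamma>. \<tau> d = d}"
      then obtain k :: nat where k: "\<tau> = \<gamma> [^]\<^bsub>?B\<^esub> k" unfolding \<Gamma>_pow by blast
      then have "s dvd k" using \<tau> fix_pow[of k] by simp
      then obtain q where "k = s * q" by (rule dvdE)
      then show "\<tau> \<in> {\<gamma> [^]\<^bsub>?B\<^esub> (s * k) | k. k \<in> (UNIV :: nat set)}" using k by blast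
    qed
    finally have "generate ?B {?g} = H" using assms(9) carG by simp
    moreover have "generate G {?g} = generate ?B {?g}"
      unfolding G by (rule B.generate_consistent) (use g sub\<Gamma> in auto)
    ultimately show ?thesis unfolding powG by simp
  qed

  have nucleus: "right_nucleus A = {g \<in> carrier A. \<forall>i. \<not> s dvd i \<longrightarrow> g i = \<zero>\<^bsub>D\<^esub>} \<and>
        (let P = skew_poly D (\<sigma> ^^ s);
             I = genideal P {skew_binomial D (\<sigma> ^^ s) r d}
         in \<exists>\<Phi> \<in> ring_iso (P Quot I) (A\<lparr>carrier := right_nucleus A\<rparr>).
              \<forall>p \<in> carrier P. deg D p < r \<longrightarrow> \<Phi> (I +>\<^bsub>P\<^esub> p) = subst_power D s p)"
    and const: "s = m \<Longrightarrow> right_nucleus A = (\<lambda>a. monom A a 0) ` carrier D"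
    if id: "\<forall>a \<in> carrier D. (\<sigma> ^^ m) a = a"
  proof -
    interpret S: skew_binom_power D \<sigma> m d s r
    proof (unfold_locales, rule \<sigma>hom)
      show "\<one>\<^bsub>D\<^esub> \<noteq> \<zero>\<^bsub>D\<^esub>" by (rule subfieldE(6)[OF cda(4)])
      show "d \<otimes>\<^bsub>D\<^esub> a = a \<otimes>\<^bsub>D\<^esub> d" if "a \<in> carrier D" for a
        using that dC cda(3) by (simp add: ring_center_def)
      show "a = \<zero>\<^bsub>D\<^esub> \<or> b = \<zero>\<^bsub>D\<^esub>"
        if ab: "a \<in> carrier D" "b \<in> carrier D" "a \<otimes>\<^bsub>D\<^esub> b = \<zero>\<^bsub>D\<^esub>" for a b
      proof (rule disjCI)
        assume "b \<noteq> \<zero>\<^bsub>D\<^esub>"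
        then have u: "b \<in> Units D" using ab(2) cda(2) by simp
        have "a = a \<otimes>\<^bsub>D\<^esub> b \<otimes>\<^bsub>D\<^esub> inv\<^bsub>D\<^esub> b" using u ab(1,2) by (simp add: D.m_assoc)
        then show "a = \<zero>\<^bsub>D\<^esub>" using u ab(3) by simp
      qed
    qed (use assms(4) dD r m2 id s(2) in auto)
    show "right_nucleus A = {g \<in> carrier A. \<forall>i. \<not> s dvd i \<longrightarrow> g i = \<zero>\<^bsub>D\<^esub>} \<and>
        (let P = skew_poly D (\<sigma> ^^ s);
             I = genideal P {skew_binomial D (\<sigma> ^^ s) r d}
         in \<exists>\<Phi> \<in> ring_iso (P Quot I) (A\<lparr>carrier := right_nucleus A\<rparr>).
              \<forall>p \<in> carrier P. deg D p < r \<longrightarrow> \<Phi> (I +>\<^bsub>P\<^esub> p) = subst_power D s p)"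
      unfolding assms(10) Let_def using S.right_nucleus_alg S.nucleus_iso_quotient by (intro conjI)
    assume sm: "s = m"
    \<comment> \<open>A multiple of \<open>m\<close> below \<open>m\<close> is \<open>0\<close>, so only constants remain.\<close>
    show "right_nucleus A = (\<lambda>a. monom A a 0) ` carrier D"
    proof
      show "(\<lambda>a. monom A a 0) ` carrier D \<subseteq> right_nucleus A"
        unfolding assms(10) S.right_nucleus_alg using assms(4) by (auto simp: S.alg_carrier)
      show "right_nucleus A \<subseteq> (\<lambda>a. monom A a 0) ` carrier D"
      proof
        fix g assume "g \<in> right_nucleus A"
        then have g: "g \<in> up D" "\<And>i. m \<le> i \<Longrightarrow> g i = \<zero>\<^bsub>D\<^esub>" "\<And>i. \<not> m dvd i \<Longrightarrow> g i = \<zero>\<^bsub>D\<^esub>"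
          unfolding assms(10) S.right_nucleus_alg sm by (auto simp: S.alg_carrier)
        have "g i = \<zero>\<^bsub>D\<^esub>" if "i \<noteq> 0" for i
          using g(2,3)[of i] that dvd_imp_le[of m i] by auto
        then have "g = monom A (g 0) 0"
          unfolding assms(10) using g(1) by (auto simp: fun_eq_iff)
        then show "g \<in> (\<lambda>a. monom A a 0) ` carrier D" using g(1) by blast
      qed
    qed
  qed
  have "s = m" if "Factorial_Ring.prime m"
    using that \<open>s dvd m\<close> s_ne prime_nat_iff by auto
  then show ?thesis
    using galois dim cyclic genG r H nucleus const by blast
qed

end
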